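(* For every $h\in(0,n)$ there exists a conformal iterated function system $\mathcal S_h$ consisting of similarities in $\mathbb R^n$ such that $\dim_{\mathcal H}(J_{\mathcal S_h})=h$ and $J_{\mathcal S_h}$ is not porous at $m_h$-a.e. $x\in J_{\mathcal S_h}$, where $m_h$ is the $h$-conformal measure of $\mathcal S_h$.
   Context: A conformal iterated function system (CIFS) in $\mathbb R^n$ consisting of similarities means: a countable (finite or infinite) alphabet $E$ with at least two elements; a compact connected set $X\subset\mathbb R^n$ with $X=\overline{\operatorname{Int}X}$; similarities $\phi_e$, $e\in E$, with contraction ratios at most a common $s\in(0,1)$ and $\phi_e(X)\subset X$; an open connected set $W\supset X$ with $\phi_e(W)\subset W$ for all $e$; and the open set condition $\phi_a(\operatorname{Int}X)\cap\phi_b(\operatorname{Int}X)=\emptyset$ for $a\ne b$ in $E$. All words over $E$ are admissible. For $\omega\in E^{\mathbb N}$, $\pi(\omega)$ is the unique point of $\bigcap_n\phi_{\omega_1}\circ\cdots\circ\phi_{\omega_n}(X)$ and the limit set is $\pi(E^{\mathbb N})$. $\|D\phi_e\|$ denotes the similarity ratio of $\phi_e$. Conformal measure: put $P(t)=\log\sum_{e\in E}\|D\phi_e\|^t$ (topological pressure). The Hausdorff dimension of the limit set equals $h=\inf\{t\ge0:P(t)\le0\}$. On bounded continuous functions $g$ on $E^{\mathbb N}$ (product of discrete topologies), $\mathcal L_tg(\omega)=\sum_{e\in E}g(e\omega)\|D\phi_e\|^t$, defined when $\sum_e\|D\phi_e\|^t<\infty$ (in particular for $t=h$). $\tilde m_h$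 is the unique Borel probability measure on $E^{\mathbb N}$ that is an eigenmeasure of the dual operator $\mathcal L_h^*$ (with eigenvalue $e^{P(h)}$), and the $h$-conformal measure is $m_h=\tilde m_h\circ\pi^{-1}$. Porosity (in $\mathbb R^n$): for a bounded $G\subset\mathbb R^n$, $x\in\mathbb R^n$, $r>0$, $\operatorname{por}(G,x,r)=\sup\{c\ge0: B(y,cr)\subset B(x,r)\setminus G\text{ for some }y\in\mathbb R^n\}$. $G$ is porous at $x$ if there are $c\in(0,1)$ and $r_0>0$ with $\operatorname{por}(G,x,r)\ge c$ for all $r\in(0,r_0)$. *)

theory Defs
  imports "HOL-Probability.Probability"
begin

section \<open>Hausdorff measure and dimension\<close>

text \<open>The weight \<open>diam(U)^s\<close> of a bounded covering set, with the usual conventions for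
  \<open>U = {}\<close> and for \<open>s = 0\<close> (note that \<open>0 powr 0 = 0\<close>).\<close>

definition hausdorff_weight :: "real \<Rightarrow> 'a::metric_space set \<Rightarrow> ennreal" where
  "hausdorff_weight s U =
     (if U = {} then 0 else if s = 0 then 1 else ennreal (diameter U powr s))"

text \<open>Boundedness has to be required separately, since \<open>diameter\<close> is unspecified on
  unbounded sets. Finite covers are included because the \<open>U i\<close> may be empty.\<close>

definition fine_covers :: "real \<Rightarrow> 'a::metric_space set \<Rightarrow> (nat \<Rightarrow> 'a set) set" where
  "fine_covers \<delta> A = {U. A \<subseteq> (\<Union>i. U i) \<and> (\<forall>i. bounded (U i) \<and> diameter (U i) \<le> \<delta>)}"

definition hausdorff_measure :: "real \<Rightarrow> 'a::metric_space set \<Rightarrow> ennreal" where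
  "hausdorff_measure s A =
     (SUP \<delta>\<in>{0<..}. INF U\<in>fine_covers \<delta> A. \<Sum>i. hausdorff_weight s (U i))"

definition hausdorff_dim :: "'a::metric_space set \<Rightarrow> ereal" where
  "hausdorff_dim A = Inf {ereal s | s. 0 \<le> s \<and> hausdorff_measure s A = 0}"


section \<open>Iterated function systems of similarities\<close>

definition similarity :: "('a::metric_space \<Rightarrow> 'a) \<Rightarrow> bool" where
  "similarity f \<longleftrightarrow> (\<exists>r>0. \<forall>x y. dist (f x) (f y) = r * dist x y)"

definition similarity_ratio :: "('a::metric_space \<Rightarrow> 'a) \<Rightarrow> real" where
  "similarity_ratio f = (THE r. \<forall>x y. dist (f x) (f y) = r * dist x y)"

text \<open>A similarity between subsets of Euclidean space with nonempty interior extends uniquely to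
  the whole space, so the maps are taken to be globally defined. Nonemptiness of \<open>X\<close> is implicit
  in the usual definition; it has to be stated since \<open>connected {}\<close> holds here.\<close>

locale similarity_cifs =
  fixes E :: "'e set" and \<phi> :: "'e \<Rightarrow> 'a::euclidean_space \<Rightarrow> 'a"
    and X W :: "'a set"
  assumes countable_alphabet: "countable E"
    and two_letters: "\<exists>a\<in>E. \<exists>b\<in>E. a \<noteq> b"
    and X_nonempty: "X \<noteq> {}"
    and X_compact: "compact X"
    and X_connected: "connected X"
    and X_regular: "X = closure (interior X)"
    and similarities: "\<And>e. e \<in> E \<Longrightarrow> similarity (\<phi> e)"
    and uniform_contraction: "\<exists>s. 0 < s \<and> s < 1 \<and> (\<forall>e\<in>E. similarity_ratio (\<phi> e) \<le> s)"
    and maps_X: "\<And>e. e \<in> E \<Longrightarrow> \<phi> e ` X \<subseteq> X"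
    and W_open: "open W"
    and W_connected: "connected W"
    and X_subset_W: "X \<subseteq> W"
    and maps_W: "\<And>e. e \<in> E \<Longrightarrow> \<phi> e ` W \<subseteq> W"
    and open_set_condition:
      "\<And>a b. a \<in> E \<Longrightarrow> b \<in> E \<Longrightarrow> a \<noteq> b \<Longrightarrow> \<phi> a ` interior X \<inter> \<phi> b ` interior X = {}"

text \<open>Infinite words are functions \<open>nat \<Rightarrow> 'e\<close>, so the first letter has index \<open>0\<close> and
  \<open>case_nat e \<omega>\<close> is the word \<open>e\<omega>\<close>.\<close>

definition word_topology :: "'e set \<Rightarrow> (nat \<Rightarrow> 'e) topology" where
  "word_topology E = product_topology (\<lambda>_. discrete_topology E) UNIV"

abbreviation words :: "'e set \<Rightarrow> (nat \<Rightarrow> 'e) set" where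
  "words E \<equiv> topspace (word_topology E)"

primrec word_map :: "('e \<Rightarrow> 'a \<Rightarrow> 'a) \<Rightarrow> (nat \<Rightarrow> 'e) \<Rightarrow> nat \<Rightarrow> 'a \<Rightarrow> 'a" where
  "word_map \<phi> \<omega> 0 = id"
| "word_map \<phi> \<omega> (Suc n) = word_map \<phi> \<omega> n \<circ> \<phi> (\<omega> n)"

definition coding_map :: "('e \<Rightarrow> 'a \<Rightarrow> 'a) \<Rightarrow> 'a set \<Rightarrow> (nat \<Rightarrow> 'e) \<Rightarrow> 'a" where
  "coding_map \<phi> X \<omega> = (THE x. x \<in> (\<Inter>n\<in>{1..}. word_map \<phi> \<omega> n ` X))"

definition limit_set :: "'e set \<Rightarrow> ('e \<Rightarrow> 'a \<Rightarrow> 'a) \<Rightarrow> 'a set \<Rightarrow> 'a set" where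
  "limit_set E \<phi> X = coding_map \<phi> X ` words E"


section \<open>Pressure, transfer operator and conformal measure\<close>

definition pressure :: "'e set \<Rightarrow> ('e \<Rightarrow> 'a::metric_space \<Rightarrow> 'a) \<Rightarrow> real \<Rightarrow> ereal" where
  "pressure E \<phi> t =
     (if (\<lambda>e. similarity_ratio (\<phi> e) powr t) summable_on E
      then ereal (ln (\<Sum>\<^sub>\<infinity>e\<in>E. similarity_ratio (\<phi> e) powr t)) else \<infinity>)"

definition transfer_op ::
  "'e set \<Rightarrow> ('e \<Rightarrow> 'a::metric_space \<Rightarrow> 'a) \<Rightarrow> real \<Rightarrow> ((nat \<Rightarrow> 'e) \<Rightarrow> real) \<Rightarrow> (nat \<Rightarrow> 'e) \<Rightarrow> real" where
  "transfer_op E \<phi> t g \<omega> = (\<Sum>\<^sub>\<infinity>e\<in>E. g (case_nat e \<omega>) * similarity_ratio (\<phi> e) powr t)"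

definition word_borel :: "'e set \<Rightarrow> (nat \<Rightarrow> 'e) measure" where
  "word_borel E = sigma (words E) {U. openin (word_topology E) U}"

text \<open>Borel probability measures \<open>M\<close> on the word space with \<open>L\<^sub>t\<^sup>* M = exp (P t) M\<close>, as functionals
  on the bounded continuous functions.\<close>

definition transfer_eigenmeasure ::
  "'e set \<Rightarrow> ('e \<Rightarrow> 'a::metric_space \<Rightarrow> 'a) \<Rightarrow> real \<Rightarrow> (nat \<Rightarrow> 'e) measure \<Rightarrow> bool" where
  "transfer_eigenmeasure E \<phi> t M \<longleftrightarrow>
     pressure E \<phi> t \<noteq> \<infinity> \<and> prob_space M \<and> sets M = sets (word_borel E) \<and>
     (\<forall>g. continuous_map (word_topology E) euclideanreal g \<and> bounded (g ` words E) \<longrightarrow>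
        (\<integral>\<omega>. transfer_op E \<phi> t g \<omega> \<partial>M) =
        exp (real_of_ereal (pressure E \<phi> t)) * (\<integral>\<omega>. g \<omega> \<partial>M))"

definition symbolic_conformal_measure ::
  "'e set \<Rightarrow> ('e \<Rightarrow> 'a::metric_space \<Rightarrow> 'a) \<Rightarrow> real \<Rightarrow> (nat \<Rightarrow> 'e) measure" where
  "symbolic_conformal_measure E \<phi> t = (THE M. transfer_eigenmeasure E \<phi> t M)"

definition conformal_measure ::
  "'e set \<Rightarrow> ('e \<Rightarrow> 'a::metric_space \<Rightarrow> 'a) \<Rightarrow> 'a set \<Rightarrow> real \<Rightarrow> 'a measure" where
  "conformal_measure E \<phi> X t =
     distr (symbolic_conformal_measure E \<phi> t) borel (coding_map \<phi> X)"


section \<open>Porosity\<close>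

text \<open>Open and closed balls give the same supremum, except that with closed balls the set may be
  empty; with open balls it always contains \<open>0\<close>. In Euclidean spaces of positive dimension it is
  bounded above by \<open>1\<close>.\<close>

definition porosity :: "'a::metric_space set \<Rightarrow> 'a \<Rightarrow> real \<Rightarrow> real" where
  "porosity G x r = Sup {c. 0 \<le> c \<and> (\<exists>y. ball y (c * r) \<subseteq> ball x r - G)}"

definition porous_at :: "'a::metric_space set \<Rightarrow> 'a \<Rightarrow> bool" where
  "porous_at G x \<longleftrightarrow>
     (\<exists>c r0. 0 < c \<and> c < 1 \<and> 0 < r0 \<and> (\<forall>r. 0 < r \<and> r < r0 \<longrightarrow> c \<le> porosity G x r))"

end

theory Submission
  imports Defs
begin

text \<open>Choose the balls of the first generation pairwise disjoint, with centres at the images of a fine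
  lattice under the inversion \<open>z \<mapsto> z / norm z ^ 2\<close>, and with ratios satisfying \<open>\<Sum>r ^ h = 1\<close>.
  Since \<open>h < n\<close>, there is room for finitely many equal balls that carry at least half of this sum, so
  the other ratios can be as small as we like. The measure on words is then Bernoulli with weights \<open>r ^ h\<close>,
  and strong separation of the finite subsystems gives dimension \<open>h\<close>.

  Close to the origin the mesh of the inverted lattice is much finer than the distance to the origin.
  Hence for every \<open>c > 0\<close> there is a letter \<open>e\<close> such that, around all points of the piece of \<open>e\<close>, the limit
  set has no hole of relative size \<open>c\<close> at one fixed scale. Almost every word contains every letter
  infinitely often, and by self-similarity the small porosity recurs at arbitrarily small scales.\<close>

section \<open>Similarities and coding by words\<close>

text \<open>A finite system with disjoint pieces has a porous limit set if its dimension is below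
  that of the space, so infinitely many letters are forced. The construction lets porosity and
  dimension depend on different data: a candidate hole is destroyed by any piece inside it, however
  small, so the centres govern porosity, while the ratios govern dimension. For the porosity
  argument any positive ratios below a quarter of the gaps between centres will do.

  Inversion supplies such centres because the lattice approximates every point of the space with
  bounded error, and near norm \<open>K\<close> the inversion divides distances by about
  \<open>K^2\<close> but takes the norm only to \<open>1 / K\<close>. Mesh relative to distance from
  the origin is thus of order \<open>1 / K\<close>, and this holds on all sides of the origin, so
  that no direction is left in which a hole could hide.

  The normalisation of the weights gives pressure 0 at \<open>h\<close>, hence eigenvalue 1. The
  eigenmeasure equation then expresses invariance under prepending an independent random letter, and
  the mass of a cylinder is the \<open>h\<close>-th power of its ratio.\<close>

lemma similarity_ratio_eqI:
  fixes f :: "'a::euclidean_space \<Rightarrow> 'a"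
  assumes "\<And>x y. dist (f x) (f y) = r * dist x y"
  shows "similarity_ratio f = r"
  unfolding similarity_ratio_def
proof (rule the_equality)
  show "\<forall>x y. dist (f x) (f y) = r * dist x y" using assms by blast
next
  fix r' assume r': "\<forall>x y. dist (f x) (f y) = r' * dist x y"
  obtain b :: 'a where "b \<in> Basis" using nonempty_Basis by blast
  then have "dist b 0 = 1" by simp
  then show "r' = r" using r'[rule_format, of b 0] assms[of b 0] by simp
qed

lemma
  fixes f :: "'a::euclidean_space \<Rightarrow> 'a"
  assumes "similarity f"
  shows dist_similarity: "dist (f x) (f y) = similarity_ratio f * dist x y"
    and similarity_ratio_pos: "0 < similarity_ratio f"
proof -
  obtain r where r: "r > 0" "\<And>x y. dist (f x) (f y) = r * dist x y"
    using assms unfolding similarity_def by blast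
  then have "similarity_ratio f = r" by (intro similarity_ratio_eqI)
  then show "dist (f x) (f y) = similarity_ratio f * dist x y" "0 < similarity_ratio f"
    using r by auto
qed

section \<open>Infinite words and their cylinders\<close>

lemma words_iff: "\<omega> \<in> words E \<longleftrightarrow> (\<forall>n. \<omega> n \<in> E)"
  by (auto simp: word_topology_def PiE_iff)

lemma case_nat_in_words: "e \<in> E \<Longrightarrow> \<omega> \<in> words E \<Longrightarrow> case_nat e \<omega> \<in> words E"
  by (auto simp: words_iff split: nat.split)

lemma word_map_case_nat:
  "word_map \<phi> (case_nat e \<omega>) (Suc n) = \<phi> e \<circ> word_map \<phi> \<omega> n"
  by (induction n) (simp_all add: fun_eq_iff)

lemma word_map_cong: "(\<And>i. i < n \<Longrightarrow> \<omega> i = \<eta> i) \<Longrightarrow> word_map \<phi> \<omega> n = word_map \<phi> \<eta> n"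
  by (induction n) auto

text \<open>A finite word is represented by any infinite word extending it, so a cylinder has many
  representatives; by \<open>cylinder_eq\<close> each of its members may serve as one.\<close>

definition cylinder :: "'e set \<Rightarrow> (nat \<Rightarrow> 'e) \<Rightarrow> nat \<Rightarrow> (nat \<Rightarrow> 'e) set" where
  "cylinder E \<omega> n = {\<eta> \<in> words E. \<forall>i<n. \<eta> i = \<omega> i}"

lemma cylinder_subset_words: "cylinder E \<omega> n \<subseteq> words E"
  by (auto simp: cylinder_def)

lemma cylinder_Suc: "cylinder E \<omega> (Suc n) = cylinder E \<omega> n \<inter> {\<eta>. \<eta> n = \<omega> n}"
  by (auto simp: cylinder_def less_Suc_eq)

lemma cylinder_refl: "\<omega> \<in> words E \<Longrightarrow> \<omega> \<in> cylinder E \<omega> n"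
  by (simp add: cylinder_def)

lemma cylinder_eq: "\<eta> \<in> cylinder E \<omega> n \<Longrightarrow> cylinder E \<omega> n = cylinder E \<eta> n"
  by (auto simp: cylinder_def)

lemma countable_cylinders:
  assumes "countable E"
  shows "countable ((\<lambda>\<omega>. cylinder E \<omega> n) ` words E)"
proof (induction n)
  case 0
  have "(\<lambda>\<omega>. cylinder E \<omega> 0) ` words E \<subseteq> {words E}" by (auto simp: cylinder_def)
  then show ?case by (meson countable_finite finite.emptyI finite_insert finite_subset)
next
  case (Suc n)
  have "(\<lambda>\<omega>. cylinder E \<omega> (Suc n)) ` words E
      \<subseteq> (\<lambda>(C, e). C \<inter> {\<eta>. \<eta> n = e}) ` (((\<lambda>\<omega>. cylinder E \<omega> n) ` words E) \<times> E)"
    by (force simp: cylinder_Suc words_iff)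
  then show ?case
    using Suc assms by (meson countable_SIGMA countable_image countable_subset)
qed

lemma openin_word_coordinate:
  "A \<subseteq> E \<Longrightarrow> openin (word_topology E) {\<omega> \<in> words E. \<omega> i \<in> A}"
  unfolding word_topology_def
  using openin_continuous_map_preimage[OF continuous_map_product_projection[of i UNIV "\<lambda>_. discrete_topology E"], of A]
  by simp

lemma openin_cylinder:
  assumes "\<omega> \<in> words E"
  shows "openin (word_topology E) (cylinder E \<omega> n)"
proof (induction n)
  case 0
  then show ?case by (simp add: cylinder_def)
next
  case (Suc n)
  have "cylinder E \<omega> (Suc n) = cylinder E \<omega> n \<inter> {\<eta> \<in> words E. \<eta> n \<in> {\<omega> n}}"
    by (auto simp: cylinder_def less_Suc_eq)
  then show ?case
    using Suc openin_word_coordinate[of "{\<omega> n}" E n] assms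
    by (metis (no_types, lifting) empty_subsetI insert_subset openin_Int words_iff)
qed

text \<open>A basic open box restricts only finitely many coordinates, so a cylinder long enough to
  fix all of them stays inside the box.\<close>

lemma openin_words_iff:
  "openin (word_topology E) U \<longleftrightarrow>
    U \<subseteq> words E \<and> (\<forall>\<omega>\<in>U. \<exists>n. cylinder E \<omega> n \<subseteq> U)"
proof (intro iffI conjI ballI)
  assume U: "openin (word_topology E) U"
  then show "U \<subseteq> words E" by (rule openin_subset)
  fix \<omega> assume "\<omega> \<in> U"
  with U obtain V where V: "finite {i. V i \<noteq> E}" "\<omega> \<in> Pi\<^sub>E UNIV V" "Pi\<^sub>E UNIV V \<subseteq> U"
    unfolding word_topology_def openin_product_topology_alt by auto
  then obtain n where n: "\<And>i. V i \<noteq> E \<Longrightarrow> i < n"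
    using finite_nat_bounded[OF V(1)] by (metis (mono_tags, lifting) lessThan_iff mem_Collect_eq subsetD)
  have "cylinder E \<omega> n \<subseteq> Pi\<^sub>E UNIV V"
    using V(2) n by (fastforce simp: cylinder_def words_iff PiE_iff)
  with V(3) show "\<exists>n. cylinder E \<omega> n \<subseteq> U" by blast
next
  assume U: "U \<subseteq> words E \<and> (\<forall>\<omega>\<in>U. \<exists>n. cylinder E \<omega> n \<subseteq> U)"
  show "openin (word_topology E) U"
    unfolding openin_subopen[of _ U]
    using U openin_cylinder cylinder_refl by (metis subsetD)
qed

lemma openin_words_cylinders:
  assumes "openin (word_topology E) U"
  shows "U = \<Union> {C \<in> (\<Union>n. (\<lambda>\<omega>. cylinder E \<omega> n) ` words E). C \<subseteq> U}"
  using assms cylinder_refl unfolding openin_words_iff by fastforce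

text \<open>This is why the transfer operator sends the indicator of a cylinder to a multiple of the
  indicator of a shorter one.\<close>

lemma cylinder_case_nat:
  "\<omega> \<in> words E \<Longrightarrow> e \<in> E \<Longrightarrow>
    case_nat e \<omega> \<in> cylinder E \<eta> (Suc n) \<longleftrightarrow> e = \<eta> 0 \<and> \<omega> \<in> cylinder E (\<lambda>i. \<eta> (Suc i)) n"
  by (auto simp: cylinder_def case_nat_in_words All_less_Suc2)

section \<open>Contraction along words, the coding map and the limit set\<close>

context similarity_cifs
begin

abbreviation ratio :: "'e \<Rightarrow> real" where
  "ratio e \<equiv> similarity_ratio (\<phi> e)"

definition word_ratio :: "(nat \<Rightarrow> 'e) \<Rightarrow> nat \<Rightarrow> real" where
  "word_ratio \<omega> n = (\<Prod>i<n. ratio (\<omega> i))"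

lemma dist_letter: "e \<in> E \<Longrightarrow> dist (\<phi> e x) (\<phi> e y) = ratio e * dist x y"
  by (rule dist_similarity[OF similarities])

lemma ratio_pos: "e \<in> E \<Longrightarrow> 0 < ratio e"
  by (rule similarity_ratio_pos[OF similarities])

lemma continuous_letter: "e \<in> E \<Longrightarrow> continuous_on S (\<phi> e)"
  using dist_letter ratio_pos
  by (intro lipschitz_on_continuous_on[of "ratio e"] lipschitz_onI) (auto intro: less_imp_le)

lemma word_ratio_pos: "\<omega> \<in> words E \<Longrightarrow> 0 < word_ratio \<omega> n"
  by (auto simp: word_ratio_def words_iff intro!: prod_pos ratio_pos)

lemma dist_word_map:
  "\<omega> \<in> words E \<Longrightarrow> dist (word_map \<phi> \<omega> n x) (word_map \<phi> \<omega> n y) = word_ratio \<omega> n * dist x y"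
  by (induction n arbitrary: x y) (auto simp: word_ratio_def dist_letter words_iff)

lemma word_map_image_mono:
  assumes "\<omega> \<in> words E" "m \<le> n"
  shows "word_map \<phi> \<omega> n ` X \<subseteq> word_map \<phi> \<omega> m ` X"
  using assms(2)
proof (induction n rule: dec_induct)
  case (step n)
  have "word_map \<phi> \<omega> (Suc n) ` X \<subseteq> word_map \<phi> \<omega> n ` X"
    using maps_X[of "\<omega> n"] assms(1) by (auto simp: words_iff image_subset_iff)
  with step show ?case by blast
qed auto

lemma compact_word_map_image:
  assumes "\<omega> \<in> words E" "compact K"
  shows "compact (word_map \<phi> \<omega> n ` K)"
  using dist_word_map[OF assms(1)] word_ratio_pos[OF assms(1), of n]
  by (intro compact_continuous_image assms lipschitz_on_continuous_on[of "word_ratio \<omega> n"] lipschitz_onI)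
     (auto intro: less_imp_le)

lemma word_ratio_le_power:
  obtains s where "0 < s" "s < 1" "\<And>\<omega> n. \<omega> \<in> words E \<Longrightarrow> word_ratio \<omega> n \<le> s ^ n"
    "\<And>e. e \<in> E \<Longrightarrow> ratio e \<le> s"
proof -
  obtain s where s: "0 < s" "s < 1" "\<And>e. e \<in> E \<Longrightarrow> ratio e \<le> s"
    using uniform_contraction by blast
  have "word_ratio \<omega> n \<le> s ^ n" if "\<omega> \<in> words E" for \<omega> n
    using that prod_mono[of "{..<n}" "\<lambda>i. ratio (\<omega> i)" "\<lambda>_. s"] s ratio_pos
    by (auto simp: word_ratio_def words_iff less_imp_le)
  with s show ?thesis using that by blast
qed

lemma word_ratio_tendsto_0: "\<omega> \<in> words E \<Longrightarrow> word_ratio \<omega> \<longlonglongrightarrow> 0"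
proof -
  assume \<omega>: "\<omega> \<in> words E"
  obtain s where s: "0 < s" "s < 1" "\<And>\<omega> n. \<omega> \<in> words E \<Longrightarrow> word_ratio \<omega> n \<le> s ^ n"
    using word_ratio_le_power by metis
  have "(\<lambda>n. s ^ n) \<longlonglongrightarrow> 0" using s by (intro LIMSEQ_power_zero) simp
  then show ?thesis
    using s(3)[OF \<omega>] word_ratio_pos[OF \<omega>]
    by (rule_tac tendsto_sandwich[OF always_eventually always_eventually tendsto_const])
       (auto intro: less_imp_le)
qed

text \<open>Two common points of the nested images are at distance at most
  \<open>word_ratio \<omega> n * diameter X\<close>, which tends to 0. The threshold
  \<open>k\<close> permits ignoring the first images, as is convenient for
  \<open>case_nat e \<omega>\<close>, where only indices of the form \<open>Suc m\<close> factor
  through \<open>\<phi> e\<close>.\<close>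

lemma coding_map_eqI:
  assumes \<omega>: "\<omega> \<in> words E" and x: "\<And>n. n \<ge> k \<Longrightarrow> x \<in> word_map \<phi> \<omega> n ` X"
  shows "coding_map \<phi> X \<omega> = x"
  unfolding coding_map_def
proof (rule the_equality)
  show "x \<in> (\<Inter>n\<in>{1..}. word_map \<phi> \<omega> n ` X)"
    using x word_map_image_mono[OF \<omega>, of _ "max k _"] by (meson INT_I max.cobounded1 max.cobounded2 subsetD)
next
  fix y assume y: "y \<in> (\<Inter>n\<in>{1..}. word_map \<phi> \<omega> n ` X)"
  have bd: "dist x y \<le> word_ratio \<omega> n * diameter X" if n: "n \<ge> max k 1" for n
  proof -
    obtain u v where "u \<in> X" "v \<in> X" "x = word_map \<phi> \<omega> n u" "y = word_map \<phi> \<omega> n v"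
      using x[of n] INT_D[OF y, of n] n by auto
    moreover from this have "dist u v \<le> diameter X"
      using X_compact compact_imp_bounded diameter_bounded_bound by blast
    ultimately show ?thesis
      using dist_word_map[OF \<omega>] word_ratio_pos[OF \<omega>] by (simp add: mult_left_mono less_imp_le)
  qed
  have "(\<lambda>n. word_ratio \<omega> n * diameter X) \<longlonglongrightarrow> 0"
    using tendsto_mult_left_zero word_ratio_tendsto_0[OF \<omega>] by blast
  then have "dist x y \<le> 0"
    by (rule LIMSEQ_le_const) (use bd in blast)
  then show "y = x" by simp
qed

lemma coding_map_in:
  assumes \<omega>: "\<omega> \<in> words E"
  shows "coding_map \<phi> X \<omega> \<in> word_map \<phi> \<omega> n ` X"
proof -
  have "\<Inter>(range (\<lambda>n. word_map \<phi> \<omega> n ` X)) \<noteq> {}"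
    by (rule compact_nest) (use X_nonempty word_map_image_mono[OF \<omega>] compact_word_map_image[OF \<omega> X_compact] in auto)
  then obtain x where "\<And>n. x \<in> word_map \<phi> \<omega> n ` X" by blast
  moreover from this have "coding_map \<phi> X \<omega> = x" by (intro coding_map_eqI[OF \<omega>, of 0])
  ultimately show ?thesis by simp
qed

lemma coding_map_in_X: "\<omega> \<in> words E \<Longrightarrow> coding_map \<phi> X \<omega> \<in> X"
  using coding_map_in[of \<omega> 0] by simp

lemma coding_map_case_nat:
  assumes "e \<in> E" "\<omega> \<in> words E"
  shows "coding_map \<phi> X (case_nat e \<omega>) = \<phi> e (coding_map \<phi> X \<omega>)"
proof (rule coding_map_eqI[where k = 1])
  show "case_nat e \<omega> \<in> words E" using assms by (rule case_nat_in_words)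
  fix n :: nat assume "n \<ge> 1"
  then obtain m where "n = Suc m" by (cases n) auto
  then show "\<phi> e (coding_map \<phi> X \<omega>) \<in> word_map \<phi> (case_nat e \<omega>) n ` X"
    using coding_map_in[OF assms(2), of m] by (auto simp: word_map_case_nat simp del: word_map.simps)
qed

lemma letter_limit_set:
  "e \<in> E \<Longrightarrow> \<phi> e ` limit_set E \<phi> X \<subseteq> limit_set E \<phi> X"
  unfolding limit_set_def using coding_map_case_nat case_nat_in_words
  by (force simp flip: coding_map_case_nat)

lemma word_map_limit_set:
  assumes "\<omega> \<in> words E"
  shows "word_map \<phi> \<omega> n ` limit_set E \<phi> X \<subseteq> limit_set E \<phi> X"
proof (induction n)
  case (Suc n)
  then show ?case
    using letter_limit_set[of "\<omega> n"] assms by (fastforce simp: words_iff)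
qed auto

lemma limit_set_nonempty: "limit_set E \<phi> X \<noteq> {}"
proof -
  obtain a where "a \<in> E" using two_letters by blast
  then have "(\<lambda>_. a) \<in> words E" by (simp add: words_iff)
  then show ?thesis unfolding limit_set_def by blast
qed

lemma limit_set_subset_X: "limit_set E \<phi> X \<subseteq> X"
  unfolding limit_set_def using coding_map_in_X by blast

lemma continuous_coding_map: "continuous_map (word_topology E) euclidean (coding_map \<phi> X)"
  unfolding continuous_map_def
proof (intro conjI allI impI)
  fix U :: "'a set" assume "openin euclidean U"
  then have "open U" by simp
  show "openin (word_topology E) {\<omega> \<in> words E. coding_map \<phi> X \<omega> \<in> U}"
    unfolding openin_words_iff
  proof (intro conjI ballI)
    fix \<omega> assume "\<omega> \<in> {\<omega> \<in> words E. coding_map \<phi> X \<omega> \<in> U}"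
    then have \<omega>: "\<omega> \<in> words E" and "coding_map \<phi> X \<omega> \<in> U" by auto
    then obtain \<epsilon> where \<epsilon>: "\<epsilon> > 0" "ball (coding_map \<phi> X \<omega>) \<epsilon> \<subseteq> U"
      using \<open>open U\<close> open_contains_ball by blast
    have "(\<lambda>n. word_ratio \<omega> n * diameter X) \<longlonglongrightarrow> 0"
      using tendsto_mult_left_zero word_ratio_tendsto_0[OF \<omega>] by blast
    then have "eventually (\<lambda>n. word_ratio \<omega> n * diameter X < \<epsilon>) sequentially"
      using \<epsilon> by (simp add: order_tendsto_iff)
    then obtain n where n: "word_ratio \<omega> n * diameter X < \<epsilon>"
      using eventually_happens by fastforce
    have "coding_map \<phi> X \<eta> \<in> U" if "\<eta> \<in> cylinder E \<omega> n" for \<eta>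
    proof -
      have \<eta>: "\<eta> \<in> words E" "word_map \<phi> \<eta> n = word_map \<phi> \<omega> n"
        using that by (auto simp: cylinder_def intro: word_map_cong)
      obtain u v where "u \<in> X" "v \<in> X" "coding_map \<phi> X \<omega> = word_map \<phi> \<omega> n u"
        "coding_map \<phi> X \<eta> = word_map \<phi> \<omega> n v"
        using coding_map_in[OF \<omega>, of n] coding_map_in[OF \<eta>(1), of n] \<eta>(2) by auto
      moreover from this have "dist u v \<le> diameter X"
        using X_compact compact_imp_bounded diameter_bounded_bound by blast
      then have "word_ratio \<omega> n * dist u v \<le> word_ratio \<omega> n * diameter X"
        using word_ratio_pos[OF \<omega>] by (simp add: mult_left_mono less_imp_le)
      ultimately have "dist (coding_map \<phi> X \<omega>) (coding_map \<phi> X \<eta>) < \<epsilon>"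
        using n dist_word_map[OF \<omega>] by simp
      then show ?thesis using \<epsilon> by auto
    qed
    then show "\<exists>n. cylinder E \<omega> n \<subseteq> {\<omega> \<in> words E. coding_map \<phi> X \<omega> \<in> U}"
      using cylinder_subset_words by blast
  qed auto
qed auto

text \<open>Tychonoff's theorem applied to the word space of a finite alphabet. Over an infinite
  alphabet compactness may fail, which is why the lower bound for the dimension passes to finite
  subsystems.\<close>

lemma compact_limit_set:
  assumes "finite E"
  shows "compact (limit_set E \<phi> X)"
proof -
  have "compact_space (word_topology E)"
    unfolding word_topology_def compact_space_product_topology
    using assms by (simp add: compact_space_discrete_topology)
  then have "compactin (word_topology E) (words E)" by (simp add: compact_space_def)
  from image_compactin[OF this continuous_coding_map] show ?thesis
    by (simp add: limit_set_def)
qed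

end

section \<open>The Bernoulli measure as unique eigenmeasure\<close>

text \<open>Two cylinders are nested or disjoint, so adding the empty set makes the family stable
  under intersection.\<close>

definition word_cylinders :: "'e set \<Rightarrow> (nat \<Rightarrow> 'e) set set" where
  "word_cylinders E = insert {} (\<Union>n. (\<lambda>\<omega>. cylinder E \<omega> n) ` words E)"

lemma word_cylinders_subset: "word_cylinders E \<subseteq> Pow (words E)"
  using cylinder_subset_words by (fastforce simp: word_cylinders_def)

lemma Int_stable_word_cylinders: "Int_stable (word_cylinders E)"
proof (rule Int_stableI)
  fix A B assume AB: "A \<in> word_cylinders E" "B \<in> word_cylinders E"
  show "A \<inter> B \<in> word_cylinders E"
  proof (cases "A \<inter> B = {}")
    case False
    then obtain \<zeta> where \<zeta>: "\<zeta> \<in> A" "\<zeta> \<in> B" by blast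
    then obtain \<omega> \<eta> m n where "A = cylinder E \<omega> m" "B = cylinder E \<eta> n"
      using AB by (auto simp: word_cylinders_def)
    then have "A = cylinder E \<zeta> m" "B = cylinder E \<zeta> n" using \<zeta> cylinder_eq by metis+
    then have "A \<inter> B = cylinder E \<zeta> (max m n)"
      by (auto simp: cylinder_def less_max_iff_disj)
    moreover have "\<zeta> \<in> words E" using \<zeta>(1) AB(1) word_cylinders_subset by blast
    ultimately show ?thesis by (auto simp: word_cylinders_def)
  qed (simp add: word_cylinders_def)
qed

lemma space_word_borel: "space (word_borel E) = words E"
  unfolding word_borel_def by (intro space_measure_of) (auto dest: openin_subset)

lemma openin_in_sets_word_borel: "openin (word_topology E) U \<Longrightarrow> U \<in> sets (word_borel E)"
  unfolding word_borel_def by (subst sets_measure_of) (auto dest: openin_subset)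

text \<open>An open set is the union of the cylinders inside it, and over a countable alphabet there
  are only countably many of them.\<close>

lemma sets_word_borel:
  assumes "countable E"
  shows "sets (word_borel E) = sigma_sets (words E) (word_cylinders E)"
proof -
  have "sigma_sets (words E) {U. openin (word_topology E) U} = sigma_sets (words E) (word_cylinders E)"
  proof (rule sigma_sets_eqI)
    fix U assume "U \<in> {U. openin (word_topology E) U}"
    then have U: "U = \<Union>{C \<in> (\<Union>n. (\<lambda>\<omega>. cylinder E \<omega> n) ` words E). C \<subseteq> U}" (is "_ = \<Union>?\<C>")
      using openin_words_cylinders by blast
    have "countable ?\<C>"
      using countable_cylinders[OF assms] by (intro countable_subset[OF Collect_restrict] countable_UN) auto
    moreover have "?\<C> \<subseteq> sigma_sets (words E) (word_cylinders E)"
      by (auto simp: word_cylinders_def intro!: sigma_sets.Basic)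
    ultimately have "\<Union>?\<C> \<in> sigma_sets (words E) (word_cylinders E)"
      by (rule sigma_algebra.countable_Union[OF sigma_algebra_sigma_sets[OF word_cylinders_subset]])
    then show "U \<in> sigma_sets (words E) (word_cylinders E)"
      by (simp only: U[symmetric])
  next
    fix C assume "C \<in> word_cylinders E"
    then have "openin (word_topology E) C"
      using openin_cylinder by (auto simp: word_cylinders_def)
    then show "C \<in> sigma_sets (words E) {U. openin (word_topology E) U}" by blast
  qed
  then show ?thesis unfolding word_borel_def
    by (subst sets_measure_of) (auto dest: openin_subset)
qed

text \<open>This makes the product measure a Borel measure on the word space: a cylinder is a finite
  intersection of coordinate conditions, and each coordinate condition is open.\<close>

lemma sets_PiM_eq_word_borel:
  assumes "countable E" "sets M = Pow E"
  shows "sets (PiM UNIV (\<lambda>_::nat. M)) = sets (word_borel E)"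
proof (rule antisym)
  have space: "space M = E" using assms(2) sets_eq_imp_space_eq[of M "count_space E"] by simp
  then have "space (PiM UNIV (\<lambda>_::nat. M)) = words E" by (simp add: space_PiM word_topology_def)
  show "sets (PiM UNIV (\<lambda>_::nat. M)) \<subseteq> sets (word_borel E)"
  proof (rule sets_PiM_in_sets)
    show "space (word_borel E) = (\<Pi>\<^sub>E i\<in>UNIV. space M)"
      by (simp add: space_word_borel space word_topology_def)
    fix i A assume "A \<in> sets M"
    then have "openin (word_topology E) {\<omega> \<in> words E. \<omega> i \<in> A}"
      using assms by (intro openin_word_coordinate) auto
    then show "{\<omega> \<in> space (word_borel E). \<omega> i \<in> A} \<in> sets (word_borel E)"
      unfolding space_word_borel by (rule openin_in_sets_word_borel)
  qed
  show "sets (word_borel E) \<subseteq> sets (PiM UNIV (\<lambda>_::nat. M))"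
    unfolding sets_word_borel[OF assms(1)] \<open>space _ = words E\<close>[symmetric]
  proof (rule sets.sigma_sets_subset, rule subsetI)
    fix C assume "C \<in> word_cylinders E"
    then consider "C = {}" | \<omega> n where "C = cylinder E \<omega> n" "\<omega> \<in> words E"
      by (auto simp: word_cylinders_def)
    then show "C \<in> sets (PiM UNIV (\<lambda>_::nat. M))"
    proof cases
      case 2
      let ?P = "PiM UNIV (\<lambda>_::nat. M)"
      have "{\<eta> \<in> space ?P. \<eta> i \<in> {\<omega> i}} \<in> sets ?P" for i
      proof -
        have "{\<omega> i} \<in> sets M" using 2(2) assms(2) by (auto simp: words_iff)
        then have "(\<lambda>\<eta>. \<eta> i) -` {\<omega> i} \<inter> space ?P \<in> sets ?P"
          by (rule measurable_sets[OF measurable_component_singleton[OF UNIV_I]])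
        then show ?thesis by (simp add: vimage_def Int_def conj_commute)
      qed
      then have "{\<eta> \<in> space ?P. \<forall>i\<in>{..<n}. \<eta> i \<in> {\<omega> i}} \<in> sets ?P"
        by (intro sets.sets_Collect_finite_All) auto
      moreover have "C = {\<eta> \<in> space ?P. \<forall>i\<in>{..<n}. \<eta> i \<in> {\<omega> i}}"
        unfolding 2(1) cylinder_def \<open>space _ = words E\<close> by auto
      ultimately show ?thesis by simp
    qed simp
  qed
qed

lemma measurable_continuous_words:
  assumes "continuous_map (word_topology E) euclidean (g :: _ \<Rightarrow> 'b::topological_space)"
  shows "g \<in> borel_measurable (word_borel E)"
proof (rule borel_measurableI)
  fix U :: "'b set" assume "open U"
  then have "openin (word_topology E) {\<omega> \<in> words E. g \<omega> \<in> U}"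
    using assms by (simp add: continuous_map_def)
  moreover have "g -` U \<inter> space (word_borel E) = {\<omega> \<in> words E. g \<omega> \<in> U}"
    by (auto simp: space_word_borel)
  ultimately show "g -` U \<inter> space (word_borel E) \<in> sets (word_borel E)"
    by (simp add: openin_in_sets_word_borel)
qed

text \<open>Cylinders are open and closed, so their indicators are admissible test functions in the
  eigenmeasure equation.\<close>

lemma continuous_indicator_cylinder:
  assumes "\<eta> \<in> words E"
  shows "continuous_map (word_topology E) euclideanreal (indicator (cylinder E \<eta> n))"
proof -
  have co: "openin (word_topology E) (words E - cylinder E \<eta> n)"
    unfolding openin_words_iff
  proof (intro conjI ballI)
    fix \<omega> assume \<omega>: "\<omega> \<in> words E - cylinder E \<eta> n"
    have "cylinder E \<omega> n \<subseteq> words E - cylinder E \<eta> n"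
      using \<omega> by (auto simp: cylinder_def)
    then show "\<exists>n'. cylinder E \<omega> n' \<subseteq> words E - cylinder E \<eta> n" by blast
  qed auto
  have "openin (word_topology E) {\<omega> \<in> words E. indicator (cylinder E \<eta> n) \<omega> \<in> U}" for U :: "real set"
  proof -
    have "{\<omega> \<in> words E. indicator (cylinder E \<eta> n) \<omega> \<in> U} =
        (if 1 \<in> U then cylinder E \<eta> n else {}) \<union> (if 0 \<in> U then words E - cylinder E \<eta> n else {})"
      using cylinder_subset_words by (auto simp: indicator_def)
    then show ?thesis using co openin_cylinder[OF assms] by auto
  qed
  then show ?thesis by (auto simp: continuous_map_def)
qed

text \<open>The weights form a probability vector, so \<open>h\<close> is a zero of the pressure and
  the eigenvalue is 1.\<close>

locale unity_cifs = similarity_cifs E \<phi> X W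
  for E :: "'e set" and \<phi> :: "'e \<Rightarrow> 'a::euclidean_space \<Rightarrow> 'a" and X W :: "'a set" +
  fixes h :: real
  assumes h_pos: "0 < h"
    and weights_sum: "((\<lambda>e. similarity_ratio (\<phi> e) powr h) has_sum 1) E"
begin

definition letter_measure :: "'e measure" where
  "letter_measure = density (count_space E) (\<lambda>e. ennreal (ratio e powr h))"

definition bernoulli_measure :: "(nat \<Rightarrow> 'e) measure" where
  "bernoulli_measure = PiM UNIV (\<lambda>_. letter_measure)"

lemma pressure_eq_0: "pressure E \<phi> h = 0"
  using weights_sum unfolding pressure_def
  by (simp add: has_sum_iff zero_ereal_def)

lemma sets_letter_measure [simp]: "sets letter_measure = Pow E"
  and space_letter_measure [simp]: "space letter_measure = E"
  by (simp_all add: letter_measure_def)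

lemma prob_space_letter_measure: "prob_space letter_measure"
proof (rule prob_spaceI)
  have as: "Infinite_Set_Sum.abs_summable_on (\<lambda>e. ratio e powr h) E"
    using weights_sum unfolding abs_summable_equivalent[symmetric] by (simp add: has_sum_imp_summable)
  then have "integrable (count_space E) (\<lambda>e. ratio e powr h)"
    "(\<integral>e. ratio e powr h \<partial>count_space E) = 1"
    using infsetsum_infsum[OF as] weights_sum
    by (auto simp: abs_summable_on_def infsetsum_def has_sum_iff)
  then have "(\<integral>\<^sup>+e. ennreal (ratio e powr h) \<partial>count_space E) = 1"
    by (subst nn_integral_eq_integral) auto
  moreover have "emeasure letter_measure (space letter_measure) = (\<integral>\<^sup>+e. ennreal (ratio e powr h) \<partial>count_space E)"
    unfolding letter_measure_def by (subst emeasure_density) (auto intro!: nn_integral_cong)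
  ultimately show "emeasure letter_measure (space letter_measure) = 1" by simp
qed

lemma sequence_space_letter_measure: "sequence_space letter_measure"
  unfolding sequence_space_def product_prob_space_def product_prob_space_axioms_def product_sigma_finite_def
  using prob_space_letter_measure
  by (auto simp: prob_space.axioms finite_measure.axioms intro!: prob_space_imp_sigma_finite)

lemma prob_space_bernoulli: "prob_space bernoulli_measure"
  unfolding bernoulli_measure_def by (intro prob_space_PiM prob_space_letter_measure)

lemma sets_bernoulli: "sets bernoulli_measure = sets (word_borel E)"
  unfolding bernoulli_measure_def
  by (intro sets_PiM_eq_word_borel countable_alphabet sets_letter_measure)

lemma space_bernoulli: "space bernoulli_measure = words E"
  using sets_eq_imp_space_eq[OF sets_bernoulli] by (simp add: space_word_borel)

text \<open>For bounded \<open>g\<close> the operator averages over a random first letter; in this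
  form Fubini's theorem applies.\<close>

lemma transfer_op_integral:
  assumes "\<And>e. e \<in> E \<Longrightarrow> \<bar>g (case_nat e \<omega>)\<bar> \<le> B"
  shows "transfer_op E \<phi> h g \<omega> = (\<integral>e. g (case_nat e \<omega>) \<partial>letter_measure)"
proof -
  have "Infinite_Set_Sum.abs_summable_on (\<lambda>e. B * ratio e powr h) E"
    using weights_sum unfolding abs_summable_equivalent[symmetric]
    by (auto simp: has_sum_imp_summable abs_mult intro!: summable_on_cmult_right)
  then have as: "Infinite_Set_Sum.abs_summable_on (\<lambda>e. g (case_nat e \<omega>) * ratio e powr h) E"
    by (rule abs_summable_on_comparison_test') (auto simp: abs_mult intro!: mult_right_mono assms)
  have "transfer_op E \<phi> h g \<omega> = infsetsum (\<lambda>e. g (case_nat e \<omega>) * ratio e powr h) E"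
    unfolding transfer_op_def infsetsum_infsum[OF as] by simp
  also have "\<dots> = (\<integral>e. g (case_nat e \<omega>) \<partial>letter_measure)"
    unfolding infsetsum_def letter_measure_def
    by (subst integral_density) (auto simp: mult.commute)
  finally show ?thesis .
qed

text \<open>Prepending an independent letter to a Bernoulli word yields a Bernoulli word. After
  Fubini the left side is the integral of \<open>g\<close> over the image measure under
  \<open>case_nat\<close>, which \<open>PiM_iter\<close> identifies with the Bernoulli
  measure.\<close>

lemma transfer_eigenmeasure_bernoulli: "transfer_eigenmeasure E \<phi> h bernoulli_measure"
  unfolding transfer_eigenmeasure_def
proof (intro conjI allI impI)
  show "pressure E \<phi> h \<noteq> \<infinity>" by (simp add: pressure_eq_0)
  show "prob_space bernoulli_measure" by (rule prob_space_bernoulli)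
  show "sets bernoulli_measure = sets (word_borel E)" by (rule sets_bernoulli)
  fix g :: "(nat \<Rightarrow> 'e) \<Rightarrow> real"
  assume g: "continuous_map (word_topology E) euclideanreal g \<and> bounded (g ` words E)"
  then obtain B where B: "\<And>\<omega>. \<omega> \<in> words E \<Longrightarrow> \<bar>g \<omega>\<bar> \<le> B"
    by (auto simp: bounded_iff)
  interpret L: prob_space letter_measure by (rule prob_space_letter_measure)
  interpret S: prob_space bernoulli_measure by (rule prob_space_bernoulli)
  interpret Q: sequence_space letter_measure by (rule sequence_space_letter_measure)
  interpret P: pair_prob_space letter_measure bernoulli_measure ..
  have meas: "g \<in> borel_measurable bernoulli_measure"
    using measurable_continuous_words g sets_bernoulli measurable_cong_sets by blast
  have shift: "(\<lambda>(e, \<omega>). case_nat e \<omega>) \<in> measurable (letter_measure \<Otimes>\<^sub>M bernoulli_measure) bernoulli_measure"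
    unfolding bernoulli_measure_def
    by (rule measurable_PiM_single') (auto simp: space_pair_measure space_PiM PiE_iff case_prod_unfold split: nat.split)
  have int: "integrable (letter_measure \<Otimes>\<^sub>M bernoulli_measure) (\<lambda>(e, \<omega>). g (case_nat e \<omega>))"
  proof (rule P.integrable_const_bound[where B = B])
    show "(\<lambda>(e, \<omega>). g (case_nat e \<omega>)) \<in> borel_measurable (letter_measure \<Otimes>\<^sub>M bernoulli_measure)"
      using measurable_compose[OF shift meas] by (simp add: case_prod_unfold)
    show "AE x in letter_measure \<Otimes>\<^sub>M bernoulli_measure. norm (case x of (e, \<omega>) \<Rightarrow> g (case_nat e \<omega>)) \<le> B"
      by (rule AE_I2) (auto simp: space_pair_measure space_bernoulli intro!: B case_nat_in_words)
  qed
  have "(\<integral>\<omega>. transfer_op E \<phi> h g \<omega> \<partial>bernoulli_measure)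
      = (\<integral>\<omega>. (\<integral>e. g (case_nat e \<omega>) \<partial>letter_measure) \<partial>bernoulli_measure)"
    by (intro Bochner_Integration.integral_cong refl transfer_op_integral[where B = B])
       (auto simp: space_bernoulli intro!: B case_nat_in_words)
  also have "\<dots> = (\<integral>x. (case x of (e, \<omega>) \<Rightarrow> g (case_nat e \<omega>)) \<partial>(letter_measure \<Otimes>\<^sub>M bernoulli_measure))"
    using P.integral_snd[OF int] by simp
  also have "\<dots> = (\<integral>\<omega>. g \<omega> \<partial>distr (letter_measure \<Otimes>\<^sub>M bernoulli_measure) bernoulli_measure (\<lambda>(e, \<omega>). case_nat e \<omega>))"
    by (subst integral_distr[OF shift meas]) (simp add: case_prod_unfold)
  also have "\<dots> = (\<integral>\<omega>. g \<omega> \<partial>bernoulli_measure)"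
    using Q.PiM_iter by (simp add: bernoulli_measure_def)
  finally show "(\<integral>\<omega>. transfer_op E \<phi> h g \<omega> \<partial>bernoulli_measure) =
      exp (real_of_ereal (pressure E \<phi> h)) * (\<integral>\<omega>. g \<omega> \<partial>bernoulli_measure)"
    by (simp add: pressure_eq_0)
qed

text \<open>Tested on the indicator of a cylinder, the equation peels off the first letter: only
  \<open>e = \<eta> 0\<close> contributes to the sum, with factor
  \<open>ratio (\<eta> 0) powr h\<close>. Since \<open>M\<close> is arbitrary, this gives uniqueness
  as well as the masses of the Bernoulli measure.\<close>

lemma eigenmeasure_cylinder:
  assumes M: "transfer_eigenmeasure E \<phi> h M" and "\<eta> \<in> words E"
  shows "measure M (cylinder E \<eta> n) = word_ratio \<eta> n powr h"
  using assms(2)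
proof (induction n arbitrary: \<eta>)
  interpret prob_space M using M by (simp add: transfer_eigenmeasure_def)
  have sets: "sets M = sets (word_borel E)" using M by (simp add: transfer_eigenmeasure_def)
  then have space: "space M = words E" using sets_eq_imp_space_eq space_word_borel by metis
  {
    case 0
    then show ?case using prob_space space by (simp add: cylinder_def word_ratio_def)
  next
    case (Suc n)
    let ?g = "indicator (cylinder E \<eta> (Suc n)) :: _ \<Rightarrow> real" and ?\<eta> = "\<lambda>i. \<eta> (Suc i)"
    have \<eta>: "?\<eta> \<in> words E" "\<eta> 0 \<in> E" using Suc.prems by (auto simp: words_iff)
    have "bounded (?g ` words E)"
      by (auto simp: bounded_iff indicator_def intro!: exI[of _ 1])
    then have "(\<integral>\<omega>. transfer_op E \<phi> h ?g \<omega> \<partial>M) = (\<integral>\<omega>. ?g \<omega> \<partial>M)"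
      using M continuous_indicator_cylinder[OF Suc.prems]
      by (simp add: transfer_eigenmeasure_def pressure_eq_0)
    moreover have "transfer_op E \<phi> h ?g \<omega> = ratio (\<eta> 0) powr h * indicator (cylinder E ?\<eta> n) \<omega>"
      if "\<omega> \<in> words E" for \<omega>
      unfolding transfer_op_def
      using \<eta> that
      by (subst infsum_cong_neutral[where T = "{\<eta> 0}" and g = "\<lambda>e. ratio e powr h * indicator (cylinder E ?\<eta> n) \<omega>"])
         (auto simp: indicator_def cylinder_case_nat)
    then have "(\<integral>\<omega>. transfer_op E \<phi> h ?g \<omega> \<partial>M) =
        (\<integral>\<omega>. ratio (\<eta> 0) powr h * indicator (cylinder E ?\<eta> n) \<omega> \<partial>M)"
      by (intro Bochner_Integration.integral_cong) (auto simp: space)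
    moreover have "cylinder E ?\<eta> n \<in> sets M" "cylinder E \<eta> (Suc n) \<in> sets M"
      using openin_in_sets_word_borel openin_cylinder \<eta> Suc.prems sets by blast+
    ultimately have "measure M (cylinder E \<eta> (Suc n)) = ratio (\<eta> 0) powr h * measure M (cylinder E ?\<eta> n)"
      by simp
    also have "\<dots> = (ratio (\<eta> 0) * word_ratio ?\<eta> n) powr h"
      using Suc.IH[OF \<eta>(1)] ratio_pos[OF \<eta>(2)] word_ratio_pos[OF \<eta>(1), of n]
      by (simp add: powr_mult less_imp_le)
    also have "ratio (\<eta> 0) * word_ratio ?\<eta> n = word_ratio \<eta> (Suc n)"
      unfolding word_ratio_def by (rule prod.lessThan_Suc_shift[symmetric])
    finally show ?case .
  }
qed

lemma eigenmeasure_unique: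
  assumes "transfer_eigenmeasure E \<phi> h M" "transfer_eigenmeasure E \<phi> h N"
  shows "M = N"
proof (rule measure_eqI_generator_eq[OF Int_stable_word_cylinders word_cylinders_subset,
      where A = "\<lambda>_. words E"])
  interpret M: prob_space M using assms by (simp add: transfer_eigenmeasure_def)
  interpret N: prob_space N using assms by (simp add: transfer_eigenmeasure_def)
  fix C assume "C \<in> word_cylinders E"
  then show "emeasure M C = emeasure N C"
    using assms eigenmeasure_cylinder
    by (auto simp: word_cylinders_def M.emeasure_eq_measure N.emeasure_eq_measure)
next
  show "range (\<lambda>_. words E) \<subseteq> word_cylinders E"
  proof -
    obtain a where "a \<in> E" using two_letters by blast
    then have "(\<lambda>_. a) \<in> words E" "words E = cylinder E (\<lambda>_. a) 0"
      by (auto simp: words_iff cylinder_def)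
    then show ?thesis unfolding word_cylinders_def by blast
  qed
qed (use assms sets_word_borel[OF countable_alphabet] in
      \<open>auto simp: transfer_eigenmeasure_def prob_space.axioms finite_measure.emeasure_finite\<close>)

text \<open>This ensures that the definite description in \<open>symbolic_conformal_measure\<close>
  denotes the intended measure.\<close>

lemma ex1_eigenmeasure: "\<exists>!M. transfer_eigenmeasure E \<phi> h M"
  using transfer_eigenmeasure_bernoulli eigenmeasure_unique by blast

lemma symbolic_conformal_measure_eq: "symbolic_conformal_measure E \<phi> h = bernoulli_measure"
  unfolding symbolic_conformal_measure_def
  using transfer_eigenmeasure_bernoulli eigenmeasure_unique by blast

lemma measurable_coding_map: "coding_map \<phi> X \<in> borel_measurable bernoulli_measure"
  using measurable_continuous_words[OF continuous_coding_map] measurable_cong_sets[OF sets_bernoulli refl]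
  by blast

end

section \<open>Hausdorff dimension\<close>

text \<open>At exponent 0 every nonempty member of a cover has weight 1. The dimension is an infimum
  over \<open>0 \<le> s\<close>, and the lower bound for positive exponents says nothing about
  \<open>s = 0\<close>.\<close>

lemma hausdorff_measure_0_nonzero:
  assumes "A \<noteq> {}"
  shows "hausdorff_measure 0 A \<noteq> 0"
proof -
  have "1 \<le> (\<Sum>i. hausdorff_weight 0 (U i))" if U: "U \<in> fine_covers 1 A" for U
  proof -
    obtain i where "U i \<noteq> {}" using assms U by (force simp: fine_covers_def)
    then have "1 \<le> (\<Sum>j\<in>{i}. hausdorff_weight 0 (U j))" by (simp add: hausdorff_weight_def)
    also have "\<dots> \<le> (\<Sum>j. hausdorff_weight 0 (U j))" by (rule sum_le_suminf) auto
    finally show ?thesis .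
  qed
  then have "1 \<le> (INF U\<in>fine_covers 1 A. \<Sum>i. hausdorff_weight 0 (U i))"
    by (rule INF_greatest)
  also have "\<dots> \<le> hausdorff_measure 0 A"
    unfolding hausdorff_measure_def by (rule SUP_upper) simp
  finally show ?thesis by auto
qed

text \<open>Countable covers reduce to finite ones: the members are enlarged to open sets at a small
  total cost, and compactness of \<open>K\<close> leaves a finite subcover.\<close>

lemma hausdorff_measure_nonzeroI:
  fixes A :: "'a::real_normed_vector set"
  assumes s: "0 < s" and c: "0 < c" and K: "compact K" "K \<subseteq> A"
    and covers: "\<And>I U. finite I \<Longrightarrow> K \<subseteq> (\<Union>i\<in>I. U i) \<Longrightarrow> (\<And>i. i \<in> I \<Longrightarrow> bounded (U i)) \<Longrightarrow>
      c \<le> (\<Sum>i\<in>(I :: nat set). diameter (U i) powr s)"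
  shows "hausdorff_measure s A \<noteq> 0"
proof
  assume zero: "hausdorff_measure s A = 0"
  have "(INF U\<in>fine_covers 1 A. \<Sum>i. hausdorff_weight s (U i)) \<le> hausdorff_measure s A"
    unfolding hausdorff_measure_def by (rule SUP_upper) simp
  \<comment> \<open>Half of \<open>c\<close> bounds the weights of the cover; the other half pays
    for the enlargements, in portions of a geometric series.\<close>
  also have "\<dots> < ennreal (c / 2)" using zero c by simp
  finally obtain U where U: "U \<in> fine_covers 1 A" and small: "(\<Sum>i. hausdorff_weight s (U i)) < ennreal (c / 2)"
    by (auto simp: INF_less_iff)
  have bdd: "bounded (U i)" for i using U by (simp add: fine_covers_def)
  have weight: "hausdorff_weight s (U i) = ennreal (diameter (U i) powr s)" for i
    using s by (simp add: hausdorff_weight_def)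
  \<comment> \<open>A member may be a single point; continuity of \<open>powr\<close> at diameter 0
    relies on \<open>0 < s\<close>.\<close>
  have "\<exists>e>0. (diameter (U i) + 2 * e) powr s < diameter (U i) powr s + c / 2 * (1 / 2) ^ Suc i" for i
  proof -
    have d: "0 \<le> diameter (U i)" by (rule diameter_ge_0[OF bdd])
    have "((\<lambda>e. (diameter (U i) + 2 * e) powr s) \<longlongrightarrow> (diameter (U i) + 2 * 0) powr s) (at_right 0)"
      using s d by (intro tendsto_powr' tendsto_intros) (auto simp: eventually_at_filter intro!: always_eventually)
    then have "eventually (\<lambda>e. (diameter (U i) + 2 * e) powr s < diameter (U i) powr s + c / 2 * (1 / 2) ^ Suc i) (at_right 0)"
      using c by (intro order_tendstoD) auto
    then have "eventually (\<lambda>e. e > 0 \<and> (diameter (U i) + 2 * e) powr s < diameter (U i) powr s + c / 2 * (1 / 2) ^ Suc i) (at_right 0)"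
      using eventually_at_right_less[of 0] by eventually_elim simp
    then show ?thesis using eventually_happens by fastforce
  qed
  then obtain \<epsilon> where \<epsilon>: "\<And>i. \<epsilon> i > 0"
    "\<And>i. (diameter (U i) + 2 * \<epsilon> i) powr s < diameter (U i) powr s + c / 2 * (1 / 2) ^ Suc i"
    by metis
  define V where "V i = (\<Union>u\<in>U i. ball u (\<epsilon> i))" for i
  have "U i \<subseteq> V i" for i
  proof
    fix x assume "x \<in> U i"
    then show "x \<in> V i" unfolding V_def using \<epsilon>(1)[of i] by (intro UN_I[of x]) auto
  qed
  then have "(\<Union>i. U i) \<subseteq> (\<Union>i. V i)" by (rule UN_mono[OF subset_refl])
  moreover have "A \<subseteq> (\<Union>i. U i)" using U by (simp add: fine_covers_def)
  ultimately have "K \<subseteq> (\<Union>i. V i)" using K(2) by (meson order_trans)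
  moreover have "open (V i)" for i unfolding V_def by auto
  ultimately obtain I where I: "finite I" "K \<subseteq> (\<Union>i\<in>I. V i)"
    using compactE_image[OF K(1), of UNIV V] by metis
  have V: "bounded (V i)" "diameter (V i) powr s \<le> diameter (U i) powr s + c / 2 * (1 / 2) ^ Suc i" for i
  proof -
    have dV: "dist x y \<le> diameter (U i) + 2 * \<epsilon> i" if xy: "x \<in> V i" "y \<in> V i" for x y
    proof -
      obtain u v where uv: "u \<in> U i" "v \<in> U i" "dist u x < \<epsilon> i" "dist v y < \<epsilon> i"
        using xy by (auto simp: V_def)
      have "dist u v \<le> diameter (U i)" using uv bdd by (intro diameter_bounded_bound)
      moreover have "dist x y \<le> dist x u + dist u v + dist v y"
        using dist_triangle[of x y u] dist_triangle[of u y v] by simp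
      ultimately show ?thesis using uv by (simp add: dist_commute)
    qed
    then show "bounded (V i)" unfolding bounded_two_points by blast
    show "diameter (V i) powr s \<le> diameter (U i) powr s + c / 2 * (1 / 2) ^ Suc i"
    proof (cases "V i = {}")
      case True
      then show ?thesis using s c by simp
    next
      case False
      have "diameter (V i) \<le> diameter (U i) + 2 * \<epsilon> i"
        using False dV by (intro diameter_le) (auto simp: dist_norm)
      then have "diameter (V i) powr s \<le> (diameter (U i) + 2 * \<epsilon> i) powr s"
        using s diameter_ge_0[OF \<open>bounded (V i)\<close>] by (intro powr_mono2) auto
      with \<epsilon>(2)[of i] show ?thesis by simp
    qed
  qed
  have "c \<le> (\<Sum>i\<in>I. diameter (V i) powr s)" using covers I V(1) by blast
  also have "\<dots> \<le> (\<Sum>i\<in>I. diameter (U i) powr s + c / 2 * (1 / 2) ^ Suc i)"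
    by (intro sum_mono V)
  also have "\<dots> = (\<Sum>i\<in>I. diameter (U i) powr s) + c / 2 * (\<Sum>i\<in>I. (1 / 2) ^ Suc i)"
    by (simp only: sum.distrib sum_distrib_left)
  also have "(\<Sum>i\<in>I. (1 / 2 :: real) ^ Suc i) \<le> (\<Sum>i. (1 / 2) ^ Suc i)"
    using I power_half_series by (intro sum_le_suminf) (auto simp: sums_iff)
  also have "(\<Sum>i. (1 / 2 :: real) ^ Suc i) = 1" using power_half_series by (simp only: sums_iff)
  also have "ennreal (\<Sum>i\<in>I. diameter (U i) powr s) = (\<Sum>i\<in>I. hausdorff_weight s (U i))"
    by (simp add: weight)
  then have "ennreal (\<Sum>i\<in>I. diameter (U i) powr s) \<le> (\<Sum>i. hausdorff_weight s (U i))"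
    using sum_le_suminf[OF summableI I(1), of "\<lambda>i. hausdorff_weight s (U i)"] by simp
  with small have "ennreal (\<Sum>i\<in>I. diameter (U i) powr s) < ennreal (c / 2)" by simp
  then have "(\<Sum>i\<in>I. diameter (U i) powr s) < c / 2" by (simp add: ennreal_less_iff sum_nonneg)
  finally show False using c by simp
qed

context similarity_cifs
begin

lemma ratio_less_1: "e \<in> E \<Longrightarrow> ratio e < 1"
  using word_ratio_le_power by (metis order_le_less_trans)

lemma subsystem:
  assumes "F \<subseteq> E" "a \<in> F" "b \<in> F" "a \<noteq> b"
  shows "similarity_cifs F \<phi> X W"
proof
  show "countable F" using assms(1) countable_alphabet by (rule countable_subset)
  show "\<exists>a\<in>F. \<exists>b\<in>F. a \<noteq> b" using assms by blast
  show "\<exists>s. 0 < s \<and> s < 1 \<and> (\<forall>e\<in>F. ratio e \<le> s)" using uniform_contraction assms(1) by blast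
  show "\<phi> a ` interior X \<inter> \<phi> b ` interior X = {}" if "a \<in> F" "b \<in> F" "a \<noteq> b" for a b
    using that assms(1) by (intro open_set_condition) auto
qed (rule X_nonempty X_compact X_connected X_regular W_open W_connected X_subset_W
      similarities[OF subsetD[OF assms(1)]] maps_X[OF subsetD[OF assms(1)]] maps_W[OF subsetD[OF assms(1)]];
    assumption)+

text \<open>Induction on the number of covering sets: if every set is smaller than the gap \<open>\<delta>\<close> between the
  pieces \<open>\<phi> a ` K\<close>, the cover splits into covers of the single pieces, which have fewer members and
  pull back to covers of \<open>K\<close>.\<close>

lemma separated_cover_sum_ge:
  assumes s: "0 < s" and F: "finite F" "F \<subseteq> E" "1 \<le> (\<Sum>a\<in>F. ratio a powr s)"
    and K: "K \<noteq> {}" "\<And>a. a \<in> F \<Longrightarrow> \<phi> a ` K \<subseteq> K"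
    and \<delta>: "0 < \<delta>" "\<And>a b x y. a \<in> F \<Longrightarrow> b \<in> F \<Longrightarrow> a \<noteq> b \<Longrightarrow> x \<in> K \<Longrightarrow> y \<in> K \<Longrightarrow>
      \<delta> \<le> dist (\<phi> a x) (\<phi> b y)"
    and I: "finite I" "K \<subseteq> (\<Union>i\<in>I. U i)" "\<And>i. i \<in> I \<Longrightarrow> bounded (U i)"
  shows "\<delta> powr s \<le> (\<Sum>i\<in>I. diameter (U i) powr s)"
  using I
proof (induction "card I" arbitrary: I U rule: less_induct)
  case less
  have ratio_lt: "ratio a powr s < 1" if "a \<in> F" for a
    using ratio_pos[of a] ratio_less_1[of a] that F(2) s powr_less_mono2[of s "ratio a" 1] by auto
  show ?case
  proof (cases "\<exists>i\<in>I. \<delta> \<le> diameter (U i)")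
    case True
    then obtain i where i: "i \<in> I" "\<delta> \<le> diameter (U i)" by blast
    then have "\<delta> powr s \<le> (\<Sum>j\<in>{i}. diameter (U j) powr s)"
      using s \<delta>(1) by (simp add: powr_mono2)
    also have "\<dots> \<le> (\<Sum>j\<in>I. diameter (U j) powr s)"
      using i less.prems by (intro sum_mono2) auto
    finally show ?thesis .
  next
    case False
    define J where "J a = {i\<in>I. U i \<inter> \<phi> a ` K \<noteq> {}}" for a
    have J_sub: "J a \<subseteq> I" for a by (auto simp: J_def)
    have J_disj: "J a \<inter> J b = {}" if ab: "a \<in> F" "b \<in> F" "a \<noteq> b" for a b
    proof (rule ccontr)
      assume "J a \<inter> J b \<noteq> {}"
      then obtain i x y where "i \<in> I" "x \<in> K" "y \<in> K" "\<phi> a x \<in> U i" "\<phi> b y \<in> U i"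
        by (auto simp: J_def)
      then have "\<delta> \<le> diameter (U i)"
        using \<delta>(2)[OF ab] diameter_bounded_bound[OF less.prems(3)] order_trans by blast
      with False \<open>i \<in> I\<close> show False by blast
    qed
    have J_ne: "J a \<noteq> {}" if "a \<in> F" for a
    proof -
      obtain x where x: "x \<in> K" using K(1) by blast
      then have "\<phi> a x \<in> K" using K(2)[OF that] by blast
      then obtain i where "i \<in> I" "\<phi> a x \<in> U i" using less.prems(2) by blast
      with x have "i \<in> J a" by (auto simp: J_def)
      then show ?thesis by blast
    qed
    have piece: "ratio a powr s * \<delta> powr s \<le> (\<Sum>i\<in>J a. diameter (U i) powr s)" if a: "a \<in> F" for a
    proof -
      have r: "ratio a > 0" using a F ratio_pos by blast
      have aE: "a \<in> E" using a F by blast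
      \<comment> \<open>A single letter would give a sum below 1. A second letter \<open>b\<close>
        occupies members of the cover that miss the piece of \<open>a\<close>, so the cover of that
        piece is strictly smaller and the induction hypothesis applies.\<close>
      obtain b where b: "b \<in> F" "b \<noteq> a"
      proof (rule ccontr)
        assume "\<not> thesis"
        then have "F = {a}" using a that by blast
        then show False using F(3) ratio_lt[OF a] by simp
      qed
      then have "J a \<subset> I" using J_disj[OF a b(1)] J_ne[OF b(1)] J_sub[of a] J_sub[of b] by blast
      then have "card (J a) < card I" by (rule psubset_card_mono[OF less.prems(1)])
      moreover have "finite (J a)" using J_sub less.prems(1) finite_subset by blast
      moreover have "K \<subseteq> (\<Union>i\<in>J a. \<phi> a -` U i)"
      proof
        fix x assume x: "x \<in> K"
        then have "\<phi> a x \<in> K" using K(2)[OF a] by blast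
        then obtain i where "i \<in> I" "\<phi> a x \<in> U i" using less.prems(2) by blast
        then show "x \<in> (\<Union>i\<in>J a. \<phi> a -` U i)" using x by (auto simp: J_def)
      qed
      moreover have pre: "bounded (\<phi> a -` U i) \<and> ratio a * diameter (\<phi> a -` U i) \<le> diameter (U i)" if i: "i \<in> J a" for i
      proof -
        have bd: "bounded (U i)" using i J_sub less.prems(3) by blast
        have d: "dist x y \<le> diameter (U i) / ratio a" if "\<phi> a x \<in> U i" "\<phi> a y \<in> U i" for x y
          using diameter_bounded_bound[OF bd that] dist_letter[OF aE] r by (simp add: field_simps)
        have "bounded (\<phi> a -` U i)" unfolding bounded_two_points using d by blast
        moreover have "diameter (\<phi> a -` U i) \<le> diameter (U i) / ratio a"
          using d r diameter_ge_0[OF bd] by (intro diameter_le) (auto simp: dist_norm)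
        ultimately show ?thesis using r by (simp add: field_simps)
      qed
      ultimately have "\<delta> powr s \<le> (\<Sum>i\<in>J a. diameter (\<phi> a -` U i) powr s)"
        by (intro less.hyps) auto
      then have "ratio a powr s * \<delta> powr s \<le> (\<Sum>i\<in>J a. ratio a powr s * diameter (\<phi> a -` U i) powr s)"
        by (simp add: mult_left_mono flip: sum_distrib_left)
      also have "\<dots> \<le> (\<Sum>i\<in>J a. diameter (U i) powr s)"
      proof (rule sum_mono)
        fix i assume "i \<in> J a"
        with pre have "0 \<le> diameter (\<phi> a -` U i)" "ratio a * diameter (\<phi> a -` U i) \<le> diameter (U i)"
          using diameter_ge_0 by blast+
        then show "ratio a powr s * diameter (\<phi> a -` U i) powr s \<le> diameter (U i) powr s"
          using r s by (simp add: powr_mono2 flip: powr_mult)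
      qed
      finally show ?thesis .
    qed
    have "\<delta> powr s \<le> (\<Sum>a\<in>F. ratio a powr s) * \<delta> powr s"
      using F(3) by (simp add: mult_le_cancel_right1)
    also have "\<dots> \<le> (\<Sum>a\<in>F. \<Sum>i\<in>J a. diameter (U i) powr s)"
      unfolding sum_distrib_right by (intro sum_mono piece)
    also have "\<dots> = (\<Sum>i\<in>(\<Union>a\<in>F. J a). diameter (U i) powr s)"
      using F J_sub less.prems(1) J_disj by (intro sum.UNION_disjoint[symmetric]) (auto intro: finite_subset)
    also have "\<dots> \<le> (\<Sum>i\<in>I. diameter (U i) powr s)"
      using J_sub less.prems(1) by (intro sum_mono2) auto
    finally show ?thesis .
  qed
qed

end

lemma finite_disjoint_compacts_separated:
  fixes K :: "'b \<Rightarrow> 'a::heine_borel set"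
  assumes "finite F" "\<And>a. a \<in> F \<Longrightarrow> compact (K a)"
    "\<And>a b. a \<in> F \<Longrightarrow> b \<in> F \<Longrightarrow> a \<noteq> b \<Longrightarrow> K a \<inter> K b = {}"
  shows "\<exists>\<delta>>0. \<forall>a\<in>F. \<forall>b\<in>F. a \<noteq> b \<longrightarrow> (\<forall>x\<in>K a. \<forall>y\<in>K b. \<delta> \<le> dist x y)"
proof -
  have "\<exists>d>0. \<forall>x\<in>K a. \<forall>y\<in>K b. d \<le> dist x y" if "a \<in> F" "b \<in> F" "a \<noteq> b" for a b
    using separate_compact_closed[of "K a" "K b"] assms that compact_imp_closed by metis
  then obtain d where d: "\<And>a b. a \<in> F \<Longrightarrow> b \<in> F \<Longrightarrow> a \<noteq> b \<Longrightarrow> d a b > 0"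
    "\<And>a b x y. a \<in> F \<Longrightarrow> b \<in> F \<Longrightarrow> a \<noteq> b \<Longrightarrow> x \<in> K a \<Longrightarrow> y \<in> K b \<Longrightarrow> d a b \<le> dist x y"
    by metis
  define D where "D = insert 1 ((\<lambda>(a, b). d a b) ` {(a, b). a \<in> F \<and> b \<in> F \<and> a \<noteq> b})"
  have "finite {(a, b). a \<in> F \<and> b \<in> F \<and> a \<noteq> b}"
    by (rule finite_subset[of _ "F \<times> F"]) (use assms in auto)
  then have D: "finite D" "D \<noteq> {}" by (auto simp: D_def)
  show ?thesis
  proof (intro exI conjI ballI impI)
    show "0 < Min D" using D d(1) by (auto simp: D_def)
    fix a b x y assume *: "a \<in> F" "b \<in> F" "a \<noteq> b" "x \<in> K a" "y \<in> K b"
    then have "d a b \<in> D" by (auto simp: D_def)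
    then have "Min D \<le> d a b" using D by simp
    also have "\<dots> \<le> dist x y" using * by (rule d(2))
    finally show "Min D \<le> dist x y" .
  qed
qed

lemma limit_set_mono: "F \<subseteq> E \<Longrightarrow> limit_set F \<phi> X \<subseteq> limit_set E \<phi> X"
  unfolding limit_set_def by (intro image_mono subsetI) (auto simp: words_iff)

lemma cylinder_disjoint:
  assumes "cylinder E \<omega> n \<noteq> cylinder E \<eta> n"
  shows "cylinder E \<omega> n \<inter> cylinder E \<eta> n = {}"
proof (rule ccontr)
  assume "\<not> ?thesis"
  then obtain \<zeta> where "\<zeta> \<in> cylinder E \<omega> n" "\<zeta> \<in> cylinder E \<eta> n" by blast
  then show False
    using assms cylinder_eq[of \<zeta> E \<omega> n] cylinder_eq[of \<zeta> E \<eta> n] by simp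
qed

text \<open>Covers and countable additivity are phrased with sequences; padding with empty sets
  turns a countable, possibly finite, family into one without repeating nonempty members.\<close>

lemma disjoint_sets_enumeration:
  assumes "countable \<C>" "\<And>A B. A \<in> \<C> \<Longrightarrow> B \<in> \<C> \<Longrightarrow> A \<noteq> B \<Longrightarrow> A \<inter> B = {}"
  shows "\<exists>C :: nat \<Rightarrow> 'a set. disjoint_family C \<and> \<Union>(range C) = \<Union>\<C> \<and> range C \<subseteq> insert {} \<C>"
proof (intro exI conjI)
  let ?C = "\<lambda>i. if i \<in> to_nat_on \<C> ` \<C> then from_nat_into \<C> i else {}"
  show "disjoint_family ?C"
    using assms by (auto simp: disjoint_family_on_def from_nat_into_to_nat_on) (metis Int_iff empty_iff)+
  show "\<Union>(range ?C) = \<Union>\<C>"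
    using assms(1) by (auto split: if_splits)
  show "range ?C \<subseteq> insert {} \<C>" using assms(1) by auto
qed

section \<open>Upper and lower bound for the dimension of the limit set\<close>

context unity_cifs
begin

text \<open>The limit set is covered by the images of the cylinders of length \<open>n\<close>. The
  weight of an image is at most \<open>D powr s * word_ratio \<omega> n powr (s - h)\<close> times
  the mass of its cylinder; the masses sum to at most 1, and
  \<open>word_ratio \<omega> n powr (s - h)\<close> tends to 0 uniformly in the word.\<close>

lemma hausdorff_measure_limit_set_eq_0:
  assumes s: "h < s"
  shows "hausdorff_measure s (limit_set E \<phi> X) = 0"
proof -
  obtain t where t: "0 < t" "t < 1" "\<And>\<omega> n. \<omega> \<in> words E \<Longrightarrow> word_ratio \<omega> n \<le> t ^ n"
    using word_ratio_le_power by metis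
  interpret S: prob_space bernoulli_measure by (rule prob_space_bernoulli)
  define D where "D = diameter X"
  have D: "0 \<le> D" unfolding D_def using X_compact compact_imp_bounded diameter_ge_0 by blast
  have bound: "(INF U\<in>fine_covers \<delta> (limit_set E \<phi> X). \<Sum>i. hausdorff_weight s (U i))
      \<le> ennreal (D powr s * (t powr (s - h)) ^ n)" if n: "t ^ n * D \<le> \<delta>" for n \<delta>
  proof -
    have cyl_disj: "A \<inter> B = {}"
      if "A \<in> (\<lambda>\<omega>. cylinder E \<omega> n) ` words E" "B \<in> (\<lambda>\<omega>. cylinder E \<omega> n) ` words E" "A \<noteq> B" for A B
      using that cylinder_disjoint by blast
    obtain C :: "nat \<Rightarrow> (nat \<Rightarrow> 'e) set" where C: "disjoint_family C"
        "\<Union>(range C) = \<Union>((\<lambda>\<omega>. cylinder E \<omega> n) ` words E)"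
        "range C \<subseteq> insert {} ((\<lambda>\<omega>. cylinder E \<omega> n) ` words E)"
      using disjoint_sets_enumeration[OF countable_cylinders[OF countable_alphabet, of n] cyl_disj] by metis
    define U where "U i = coding_map \<phi> X ` C i" for i
    have C_cases: "C i = {} \<or> (\<exists>\<omega>\<in>words E. C i = cylinder E \<omega> n)" for i using C(3) by blast
    have C_sets: "C i \<in> sets bernoulli_measure" for i
      using C_cases[of i] openin_in_sets_word_borel[OF openin_cylinder] sets_bernoulli by auto
    have U_cyl: "bounded (U i) \<and> diameter (U i) \<le> word_ratio \<omega> n * D"
      if \<omega>: "\<omega> \<in> words E" and Ci: "C i = cylinder E \<omega> n" for i \<omega>
    proof -
      have sub: "U i \<subseteq> word_map \<phi> \<omega> n ` X"
      proof
        fix x assume "x \<in> U i"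
        then obtain \<eta> where \<eta>: "\<eta> \<in> cylinder E \<omega> n" "x = coding_map \<phi> X \<eta>" by (auto simp: U_def Ci)
        then have "word_map \<phi> \<eta> n = word_map \<phi> \<omega> n" by (intro word_map_cong) (auto simp: cylinder_def)
        moreover have "\<eta> \<in> words E" using \<eta> cylinder_subset_words by blast
        ultimately show "x \<in> word_map \<phi> \<omega> n ` X" using coding_map_in[of \<eta> n] \<eta> by simp
      qed
      have "dist x y \<le> word_ratio \<omega> n * D" if "x \<in> U i" "y \<in> U i" for x y
      proof -
        obtain u v where "u \<in> X" "v \<in> X" "x = word_map \<phi> \<omega> n u" "y = word_map \<phi> \<omega> n v"
          using sub \<open>x \<in> U i\<close> \<open>y \<in> U i\<close> by blast
        moreover from this have "dist u v \<le> D"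
          unfolding D_def using X_compact compact_imp_bounded diameter_bounded_bound by blast
        ultimately show ?thesis
          using dist_word_map[OF \<omega>] word_ratio_pos[OF \<omega>] by (simp add: mult_left_mono less_imp_le)
      qed
      moreover have "bounded (U i)"
        using sub compact_word_map_image[OF \<omega> X_compact] bounded_subset compact_imp_bounded by blast
      ultimately show ?thesis
        using word_ratio_pos[OF \<omega>, of n] D by (auto simp: dist_norm intro!: diameter_le)
    qed
    have "U \<in> fine_covers \<delta> (limit_set E \<phi> X)"
      unfolding fine_covers_def
    proof (intro CollectI conjI allI)
      have "words E \<subseteq> \<Union>(range C)" unfolding C(2) using cylinder_refl by fastforce
      then show "limit_set E \<phi> X \<subseteq> (\<Union>i. U i)" unfolding limit_set_def U_def by blast
      fix i
      \<comment> \<open>Needed for the padding members, which are empty and have diameter 0.\<close>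
      have "0 \<le> \<delta>" using n D t(1) by (meson less_imp_le mult_nonneg_nonneg order_trans zero_le_power)
      show "bounded (U i)" using C_cases[of i] U_cyl by (auto simp: U_def)
      show "diameter (U i) \<le> \<delta>"
      proof (cases "C i = {}")
        case True
        then show ?thesis using \<open>0 \<le> \<delta>\<close> by (simp add: U_def)
      next
        case False
        then obtain \<omega> where \<omega>: "\<omega> \<in> words E" "C i = cylinder E \<omega> n" using C_cases by blast
        have "diameter (U i) \<le> word_ratio \<omega> n * D" using U_cyl[OF \<omega>] by blast
        also have "\<dots> \<le> t ^ n * D" using t(3)[OF \<omega>(1)] D by (intro mult_right_mono)
        finally show ?thesis using n by simp
      qed
    qed
    then have "(INF U\<in>fine_covers \<delta> (limit_set E \<phi> X). \<Sum>i. hausdorff_weight s (U i))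
        \<le> (\<Sum>i. hausdorff_weight s (U i))" by (rule INF_lower)
    also have "\<dots> \<le> (\<Sum>i. ennreal (D powr s * (t powr (s - h)) ^ n) * emeasure bernoulli_measure (C i))"
    proof (intro suminf_le summableI)
      fix i
      show "hausdorff_weight s (U i) \<le> ennreal (D powr s * (t powr (s - h)) ^ n) * emeasure bernoulli_measure (C i)"
      proof (cases "C i = {}")
        case True
        then show ?thesis by (simp add: U_def hausdorff_weight_def)
      next
        case False
        then obtain \<omega> where \<omega>: "\<omega> \<in> words E" "C i = cylinder E \<omega> n" using C_cases by blast
        have r: "0 < word_ratio \<omega> n" by (rule word_ratio_pos[OF \<omega>(1)])
        have "diameter (U i) powr s \<le> (word_ratio \<omega> n * D) powr s"
          using U_cyl[OF \<omega>] s h_pos diameter_ge_0 by (intro powr_mono2) auto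
        also have "(word_ratio \<omega> n * D) powr s = D powr s * word_ratio \<omega> n powr (s - h) * word_ratio \<omega> n powr h"
          using r D by (simp add: powr_mult flip: powr_add)
        also have "\<dots> \<le> D powr s * (t powr (s - h)) ^ n * word_ratio \<omega> n powr h"
        proof -
          have "word_ratio \<omega> n powr (s - h) \<le> (t ^ n) powr (s - h)"
            using t(3)[OF \<omega>(1)] r s by (intro powr_mono2) auto
          also have "\<dots> = (t powr (s - h)) ^ n"
            using t(1) by (simp add: powr_powr mult.commute flip: powr_realpow)
          finally show ?thesis by (intro mult_right_mono mult_left_mono) auto
        qed
        also have "word_ratio \<omega> n powr h = measure bernoulli_measure (C i)"
          using eigenmeasure_cylinder[OF transfer_eigenmeasure_bernoulli \<omega>(1)] \<omega>(2) by simp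
        finally have "ennreal (diameter (U i) powr s)
            \<le> ennreal (D powr s * (t powr (s - h)) ^ n) * emeasure bernoulli_measure (C i)"
          by (simp add: S.emeasure_eq_measure ennreal_leI flip: ennreal_mult'')
        then show ?thesis
          using s h_pos by (simp add: hausdorff_weight_def)
      qed
    qed
    also have "\<dots> = ennreal (D powr s * (t powr (s - h)) ^ n) * emeasure bernoulli_measure (\<Union>(range C))"
      using C(1) C_sets by (subst ennreal_suminf_cmult) (simp add: suminf_emeasure image_subset_iff)
    also have "\<dots> \<le> ennreal (D powr s * (t powr (s - h)) ^ n) * 1"
      by (intro mult_left_mono S.measure_le_1) auto
    finally show ?thesis by simp
  qed
  have "(INF U\<in>fine_covers \<delta> (limit_set E \<phi> X). \<Sum>i. hausdorff_weight s (U i)) \<le> 0" if \<delta>: "\<delta> > 0" for \<delta>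
  proof -
    have "(\<lambda>n. D powr s * (t powr (s - h)) ^ n) \<longlonglongrightarrow> D powr s * 0"
      using t s by (intro tendsto_mult tendsto_const LIMSEQ_power_zero)
        (use t s powr_less_mono2[of "s - h" t 1] in auto)
    then have lim: "(\<lambda>n. ennreal (D powr s * (t powr (s - h)) ^ n)) \<longlonglongrightarrow> ennreal (D powr s * 0)"
      by (rule tendsto_ennrealI)
    have "(\<lambda>n. t ^ n * D) \<longlonglongrightarrow> 0"
      using t by (intro tendsto_mult_left_zero LIMSEQ_power_zero) simp
    then have "eventually (\<lambda>n. t ^ n * D < \<delta>) sequentially"
      using \<delta> by (simp add: order_tendsto_iff)
    then obtain N where "\<And>n. n \<ge> N \<Longrightarrow> t ^ n * D < \<delta>"
      unfolding eventually_sequentially by blast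
    then have "\<exists>N. \<forall>n\<ge>N. (INF U\<in>fine_covers \<delta> (limit_set E \<phi> X). \<Sum>i. hausdorff_weight s (U i))
        \<le> ennreal (D powr s * (t powr (s - h)) ^ n)"
      using bound by (meson less_imp_le)
    then have "(INF U\<in>fine_covers \<delta> (limit_set E \<phi> X). \<Sum>i. hausdorff_weight s (U i)) \<le> ennreal (D powr s * 0)"
      by (rule LIMSEQ_le_const[OF lim])
    then show ?thesis by simp
  qed
  then have "hausdorff_measure s (limit_set E \<phi> X) \<le> 0"
    unfolding hausdorff_measure_def by (intro SUP_least) auto
  then show ?thesis by simp
qed

text \<open>Lowering the exponent below \<open>h\<close> raises every summand, so finitely many
  letters already have sum at least 1 at exponent \<open>s\<close>. Their limit set is compact, and
  disjointness of the compact pieces, which is stronger than the open set condition, gives a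
  positive gap \<open>\<delta>\<close>.\<close>

lemma hausdorff_measure_limit_set_neq_0:
  assumes disj: "\<And>a b. a \<in> E \<Longrightarrow> b \<in> E \<Longrightarrow> a \<noteq> b \<Longrightarrow> \<phi> a ` X \<inter> \<phi> b ` X = {}"
    and s: "0 < s" "s < h"
  shows "hausdorff_measure s (limit_set E \<phi> X) \<noteq> 0"
proof -
  obtain e where e: "e \<in> E" using two_letters by blast
  have pw: "ratio a powr h < ratio a powr s" if "a \<in> E" for a
    using s ratio_less_1[OF that] ratio_pos[OF that] by (intro powr_less_mono') auto
  \<comment> \<open>The tolerance is what the single letter \<open>e\<close> gains when the exponent
    drops from \<open>h\<close> to \<open>s\<close>; including \<open>e\<close> in \<open>F\<close>
    therefore compensates the missing mass.\<close>
  obtain F0 where F0: "finite F0" "F0 \<subseteq> E" "dist (\<Sum>a\<in>F0. ratio a powr h) 1 \<le> ratio e powr s - ratio e powr h"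
    using has_sum_finite_approximation[OF weights_sum, of "ratio e powr s - ratio e powr h"] pw[OF e] by auto
  define F where "F = insert e F0"
  have F: "finite F" "F \<subseteq> E" "e \<in> F" using F0 e by (auto simp: F_def)
  have "1 \<le> (\<Sum>a\<in>F0. ratio a powr h) + (ratio e powr s - ratio e powr h)"
    using F0(3) by (auto simp: dist_real_def)
  also have "(\<Sum>a\<in>F0. ratio a powr h) \<le> (\<Sum>a\<in>F. ratio a powr h)"
    using F by (intro sum_mono2) (auto simp: F_def)
  also have "\<dots> = ratio e powr h + (\<Sum>a\<in>F - {e}. ratio a powr h)"
    using F by (simp add: sum.remove)
  also have "(\<Sum>a\<in>F - {e}. ratio a powr h) \<le> (\<Sum>a\<in>F - {e}. ratio a powr s)"
    using F pw by (intro sum_mono less_imp_le) auto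
  also have "ratio e powr h + (\<Sum>a\<in>F - {e}. ratio a powr s) + (ratio e powr s - ratio e powr h) = (\<Sum>a\<in>F. ratio a powr s)"
    using F by (simp add: sum.remove)
  finally have sum: "1 \<le> (\<Sum>a\<in>F. ratio a powr s)" by simp
  obtain b where b: "b \<in> F" "e \<noteq> b"
  proof (rule ccontr)
    assume "\<not> thesis"
    then have "F = {e}" using F that by blast
    then show False
      using sum ratio_less_1[OF e] ratio_pos[OF e] s powr_less_mono2[of s "ratio e" 1] by simp
  qed
  interpret F: similarity_cifs F \<phi> X W
    by (rule subsystem[OF F(2,3) b])
  have compact: "compact (\<phi> a ` X)" if "a \<in> F" for a
    using that F by (intro compact_continuous_image continuous_letter X_compact) auto
  have disjF: "\<phi> a ` X \<inter> \<phi> b ` X = {}" if "a \<in> F" "b \<in> F" "a \<noteq> b" for a b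
    using that F disj by blast
  obtain \<delta> where \<delta>: "0 < \<delta>"
      "\<forall>a\<in>F. \<forall>b\<in>F. a \<noteq> b \<longrightarrow> (\<forall>x\<in>\<phi> a ` X. \<forall>y\<in>\<phi> b ` X. \<delta> \<le> dist x y)"
    using finite_disjoint_compacts_separated[OF F(1), of "\<lambda>a. \<phi> a ` X", OF compact disjF] by auto
  let ?K = "limit_set F \<phi> X"
  show ?thesis
  proof (rule hausdorff_measure_nonzeroI[OF s(1) _ F.compact_limit_set[OF F(1)] limit_set_mono[OF F(2)]])
    show "0 < \<delta> powr s" using \<delta>(1) by simp
    fix I :: "nat set" and U
    assume IU: "finite I" "?K \<subseteq> (\<Union>i\<in>I. U i)" "\<And>i. i \<in> I \<Longrightarrow> bounded (U i)"
    show "\<delta> powr s \<le> (\<Sum>i\<in>I. diameter (U i) powr s)"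
    proof (rule separated_cover_sum_ge[OF s(1) F(1,2) sum F.limit_set_nonempty F.letter_limit_set \<delta>(1) _ IU])
      show "\<delta> \<le> dist (\<phi> a x) (\<phi> b y)" if "a \<in> F" "b \<in> F" "a \<noteq> b" "x \<in> ?K" "y \<in> ?K" for a b x y
        using that F.limit_set_subset_X by (intro \<delta>(2)[rule_format]) auto
    qed
  qed
qed

lemma hausdorff_dim_limit_set:
  assumes disj: "\<And>a b. a \<in> E \<Longrightarrow> b \<in> E \<Longrightarrow> a \<noteq> b \<Longrightarrow> \<phi> a ` X \<inter> \<phi> b ` X = {}"
  shows "hausdorff_dim (limit_set E \<phi> X) = ereal h"
proof (rule antisym)
  show "hausdorff_dim (limit_set E \<phi> X) \<le> ereal h"
  proof (rule ereal_le_epsilon2)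
    fix e :: real assume "0 < e"
    then have "hausdorff_measure (h + e) (limit_set E \<phi> X) = 0" "0 \<le> h + e"
      using hausdorff_measure_limit_set_eq_0 h_pos by auto
    then show "hausdorff_dim (limit_set E \<phi> X) \<le> ereal h + ereal e"
      unfolding hausdorff_dim_def by (intro Inf_lower) auto
  qed
  show "ereal h \<le> hausdorff_dim (limit_set E \<phi> X)"
    unfolding hausdorff_dim_def
  proof (rule Inf_greatest)
    fix x assume "x \<in> {ereal s |s. 0 \<le> s \<and> hausdorff_measure s (limit_set E \<phi> X) = 0}"
    then obtain s where s: "x = ereal s" "0 \<le> s" "hausdorff_measure s (limit_set E \<phi> X) = 0" by blast
    have "s \<noteq> 0" using s(3) hausdorff_measure_0_nonzero[OF limit_set_nonempty] by metis
    then have "0 < s" using s(2) by simp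
    then have "\<not> s < h" using s(3) hausdorff_measure_limit_set_neq_0[OF disj, of s] by blast
    then show "ereal h \<le> x" using s(1) by simp
  qed
qed

end

section \<open>Porosity\<close>

text \<open>After subtracting the value at 0 and dividing by the ratio, an isometry fixing the
  origin remains; it is orthogonal, hence onto. Surjectivity is what allows the centre of a hole to
  be pulled back.\<close>

lemma similarity_surj:
  fixes f :: "'a::euclidean_space \<Rightarrow> 'a"
  assumes "similarity f"
  shows "\<exists>x. f x = y"
proof -
  let ?r = "similarity_ratio f"
  have r: "?r > 0" "\<And>x y. dist (f x) (f y) = ?r * dist x y"
    using assms similarity_ratio_pos dist_similarity by blast+
  define g where "g x = (1 / ?r) *\<^sub>R (f x - f 0)" for x
  have "dist (g x) (g y) = dist x y" for x y
  proof -
    have "g x - g y = (1 / ?r) *\<^sub>R (f x - f y)" by (simp add: g_def algebra_simps)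
    then show ?thesis using r by (simp add: dist_norm)
  qed
  moreover have "g 0 = 0" by (simp add: g_def)
  ultimately have "orthogonal_transformation g"
    by (simp add: orthogonal_transformation_isometry)
  then have "surj g" by (rule orthogonal_transformation_surj)
  then obtain x where "g x = (1 / ?r) *\<^sub>R (y - f 0)" by (metis surjD)
  then have "f x = y" using r(1) by (simp add: g_def)
  then show ?thesis ..
qed

lemma countable_word_maps:
  assumes "countable E"
  shows "countable ((\<lambda>\<omega>. word_map \<phi> \<omega> n) ` words E)"
proof (induction n)
  case 0
  have "(\<lambda>\<omega>. word_map \<phi> \<omega> 0) ` words E \<subseteq> {id}" by auto
  then show ?case by (meson countable_finite finite.emptyI finite_insert finite_subset)
next
  case (Suc n)
  have "(\<lambda>\<omega>. word_map \<phi> \<omega> (Suc n)) ` words E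
      \<subseteq> (\<lambda>(f, e). f \<circ> \<phi> e) ` (((\<lambda>\<omega>. word_map \<phi> \<omega> n) ` words E) \<times> E)"
    by (force simp: words_iff)
  then show ?case
    using Suc assms by (meson countable_SIGMA countable_image countable_subset)
qed

context similarity_cifs
begin

lemma word_map_surj: "\<omega> \<in> words E \<Longrightarrow> \<exists>x. word_map \<phi> \<omega> n x = y"
proof (induction n arbitrary: y)
  case (Suc n)
  then obtain z where z: "word_map \<phi> \<omega> n z = y" by blast
  obtain x where "\<phi> (\<omega> n) x = z"
    using similarity_surj[OF similarities] Suc.prems by (metis words_iff)
  with z show ?case by auto
qed auto

definition dense_letter :: "real \<Rightarrow> 'e \<Rightarrow> real \<Rightarrow> bool" where
  "dense_letter c e R \<longleftrightarrow> e \<in> E \<and> 0 < R \<and>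
    (\<forall>x\<in>\<phi> e ` X. \<forall>y. ball y (c * R) \<subseteq> ball x R \<longrightarrow> (\<exists>l\<in>E. \<phi> l ` X \<subseteq> ball y (c * R)))"

lemma porosity_word_map_le:
  assumes c: "0 < c" and e: "dense_letter c e R" and \<omega>: "\<omega> \<in> words E"
    and x: "x \<in> word_map \<phi> \<omega> n ` \<phi> e ` X"
  shows "porosity (limit_set E \<phi> X) x (word_ratio \<omega> n * R) \<le> c"
proof -
  define f where "f = word_map \<phi> \<omega> n"
  define \<rho> where "\<rho> = word_ratio \<omega> n"
  have \<rho>: "0 < \<rho>" and f: "\<And>u v. dist (f u) (f v) = \<rho> * dist u v"
    using word_ratio_pos[OF \<omega>] dist_word_map[OF \<omega>] by (simp_all add: f_def \<rho>_def)
  obtain x' where x': "x' \<in> \<phi> e ` X" "x = f x'" using x by (auto simp: f_def)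
  have R: "0 < R" using e by (simp add: dense_letter_def)
  have le: "c' \<le> c" if sub: "ball y (c' * (\<rho> * R)) \<subseteq> ball x (\<rho> * R) - limit_set E \<phi> X" for c' y
  proof (rule ccontr)
    assume "\<not> c' \<le> c"
    then have "c * (\<rho> * R) \<le> c' * (\<rho> * R)" using \<rho> R by (intro mult_right_mono) auto
    then have sub: "ball y (c * (\<rho> * R)) \<subseteq> ball x (\<rho> * R) - limit_set E \<phi> X"
      using sub subset_ball order_trans by blast
    obtain y' where y': "f y' = y" using word_map_surj[OF \<omega>] f_def by blast
    have f_ball: "f z \<in> ball y (c * (\<rho> * R))" if "z \<in> ball y' (c * R)" for z
    proof -
      have "\<rho> * dist y' z < \<rho> * (c * R)" using that \<rho> by simp
      then show ?thesis using f[of y' z] y' by (simp add: mult_ac)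
    qed
    have "ball y' (c * R) \<subseteq> ball x' R"
    proof
      fix z assume "z \<in> ball y' (c * R)"
      then have "f z \<in> ball x (\<rho> * R)" using f_ball sub by blast
      then have "\<rho> * dist x' z < \<rho> * R" using f[of x' z] x'(2) by simp
      then show "z \<in> ball x' R" using \<rho> by simp
    qed
    then obtain l where l: "l \<in> E" "\<phi> l ` X \<subseteq> ball y' (c * R)"
      using e x'(1) unfolding dense_letter_def by blast
    obtain p where p: "p \<in> limit_set E \<phi> X" using limit_set_nonempty by blast
    then have "\<phi> l p \<in> limit_set E \<phi> X" "p \<in> X"
      using letter_limit_set[OF l(1)] limit_set_subset_X by blast+
    then have "f (\<phi> l p) \<in> limit_set E \<phi> X" "f (\<phi> l p) \<in> ball y (c * (\<rho> * R))"
      using word_map_limit_set[OF \<omega>, of n] l(2) f_ball by (auto simp: f_def)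
    with sub show False by blast
  qed
  show ?thesis
    unfolding porosity_def \<rho>_def[symmetric]
  proof (rule cSup_least)
    \<comment> \<open>The open ball of radius 0 is empty, so 0 belongs to the set and the supremum
      is not over the empty set.\<close>
    show "{c. 0 \<le> c \<and> (\<exists>y. ball y (c * (\<rho> * R)) \<subseteq> ball x (\<rho> * R) - limit_set E \<phi> X)} \<noteq> {}"
      by (auto intro!: exI[of _ 0])
  qed (use le in auto)
qed

text \<open>The bound \<open>B c\<close> does not depend on \<open>m\<close>, so a large
  \<open>m\<close> brings the radius \<open>word_ratio \<omega> n * R\<close> below the threshold
  \<open>r0\<close> of any claimed porosity.\<close>

lemma not_porous_atI:
  assumes "\<And>c m. 0 < c \<Longrightarrow> \<exists>c' e R. \<exists>n\<ge>m. \<exists>\<omega>\<in>words E. 0 < c' \<and> c' < c \<and> R \<le> B c \<and>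
    dense_letter c' e R \<and> x \<in> word_map \<phi> \<omega> n ` \<phi> e ` X"
  shows "\<not> porous_at (limit_set E \<phi> X) x"
proof
  assume "porous_at (limit_set E \<phi> X) x"
  then obtain c r0 where c: "0 < c" "0 < r0" "\<And>r. 0 < r \<Longrightarrow> r < r0 \<Longrightarrow> c \<le> porosity (limit_set E \<phi> X) x r"
    unfolding porous_at_def by blast
  obtain t where t: "0 < t" "t < 1" "\<And>\<omega> n. \<omega> \<in> words E \<Longrightarrow> word_ratio \<omega> n \<le> t ^ n"
    using word_ratio_le_power by metis
  have "(\<lambda>n. t ^ n * B c) \<longlonglongrightarrow> 0"
    using t by (intro tendsto_mult_left_zero LIMSEQ_power_zero) simp
  then have "eventually (\<lambda>n. t ^ n * B c < r0) sequentially"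
    using c by (simp add: order_tendsto_iff)
  then obtain m where m: "\<And>n. n \<ge> m \<Longrightarrow> t ^ n * B c < r0"
    unfolding eventually_sequentially by blast
  obtain c' e R n \<omega> where *: "n \<ge> m" "\<omega> \<in> words E" "0 < c'" "c' < c" "R \<le> B c" "dense_letter c' e R"
    "x \<in> word_map \<phi> \<omega> n ` \<phi> e ` X"
    using assms[OF c(1), of m] by (elim exE conjE bexE) metis
  have R: "0 < R" using *(6) by (simp add: dense_letter_def)
  have "word_ratio \<omega> n * R \<le> t ^ n * B c"
    using t(1,3) *(2,5) R by (intro mult_mono) auto
  then have "c \<le> porosity (limit_set E \<phi> X) x (word_ratio \<omega> n * R)"
    using m[OF *(1)] R word_ratio_pos[OF *(2)] by (intro c(3)) auto
  also have "\<dots> \<le> c'" by (rule porosity_word_map_le[OF *(3,6,2,7)])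
  finally show False using *(4) by simp
qed

end

section \<open>Almost sure recurrence of letters and failure of porosity\<close>

context unity_cifs
begin

text \<open>By independence, the letter is avoided at \<open>n\<close> successive places with
  probability \<open>p ^ n\<close>, where \<open>p < 1\<close> is the mass of the other
  letters.\<close>

lemma AE_letter_occurs:
  assumes e: "e \<in> E"
  shows "AE \<omega> in bernoulli_measure. \<exists>i\<ge>m. \<omega> i = e"
proof -
  interpret L: prob_space letter_measure by (rule prob_space_letter_measure)
  interpret S: prob_space bernoulli_measure by (rule prob_space_bernoulli)
  interpret Q: sequence_space letter_measure by (rule sequence_space_letter_measure)
  define p where "p = measure letter_measure (E - {e})"
  define A where "A n = {\<omega> \<in> space bernoulli_measure. \<forall>i\<in>{m..<m + n}. \<omega> i \<in> E - {e}}" for n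
  have "emeasure letter_measure {e} = ennreal (ratio e powr h)"
    unfolding letter_measure_def using e
    by (subst emeasure_density) (auto simp: nn_integral_indicator_singleton')
  then have "0 < measure letter_measure {e}"
    using ratio_pos[OF e] by (simp add: measure_def)
  moreover have "p = 1 - measure letter_measure {e}"
    unfolding p_def using L.prob_compl[of "{e}"] e by simp
  ultimately have p: "0 \<le> p" "p < 1" by (simp_all add: p_def)
  have A: "measure bernoulli_measure (A n) = p ^ n" for n
  proof -
    have "emeasure bernoulli_measure (A n) = (\<Prod>i\<in>{m..<m + n}. emeasure letter_measure (E - {e}))"
      unfolding A_def bernoulli_measure_def by (rule Q.emeasure_PiM_Collect) auto
    also have "\<dots> = ennreal (p ^ n)"
      by (simp add: p_def L.emeasure_eq_measure ennreal_power)
    finally show ?thesis using p by (simp add: measure_def)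
  qed
  have A_sets: "A n \<in> sets bernoulli_measure" for n
  proof -
    have "{\<omega> \<in> space bernoulli_measure. \<omega> i \<in> E - {e}} \<in> sets bernoulli_measure" for i
      unfolding space_bernoulli sets_bernoulli
      by (intro openin_in_sets_word_borel openin_word_coordinate) auto
    then show ?thesis unfolding A_def by (intro sets.sets_Collect_finite_All) auto
  qed
  have "measure bernoulli_measure (\<Inter>n. A n) \<le> p ^ n" for n
    unfolding A[symmetric] using A_sets by (intro S.finite_measure_mono) auto
  moreover have "(\<lambda>n. p ^ n) \<longlonglongrightarrow> 0" using p by (intro LIMSEQ_power_zero) simp
  ultimately have "measure bernoulli_measure (\<Inter>n. A n) \<le> 0"
    by (intro LIMSEQ_le_const) auto
  then have "(\<Inter>n. A n) \<in> null_sets bernoulli_measure"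
    using A_sets by (intro null_setsI) (auto simp: S.emeasure_eq_measure intro!: antisym)
  then show ?thesis
  proof (rule AE_I')
    show "{\<omega> \<in> space bernoulli_measure. \<not> (\<exists>i\<ge>m. \<omega> i = e)} \<subseteq> (\<Inter>n. A n)"
      by (auto simp: A_def space_bernoulli words_iff)
  qed
qed

text \<open>An almost sure statement passes to the image measure through a Borel set of points. That
  set is \<open>G\<close>, the points that lie in copies of the piece of every \<open>e k\<close> at
  arbitrarily deep levels; measurability of the porosity condition is thereby avoided.\<close>

lemma AE_not_porous:
  assumes dense: "\<And>c. 0 < c \<Longrightarrow> \<exists>e R. dense_letter c e R"
  shows "AE x in conformal_measure E \<phi> X h. \<not> porous_at (limit_set E \<phi> X) x"
proof -
  have "\<exists>e R. dense_letter (1 / Suc k) e R" for k :: nat by (rule dense) simp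
  then obtain e R where eR: "\<And>k::nat. dense_letter (1 / Suc k) (e k) (R k)" by metis
  have eE: "e k \<in> E" for k using eR[of k] by (simp add: dense_letter_def)
  define H where "H k n = (\<Union>\<omega>\<in>words E. word_map \<phi> \<omega> n ` \<phi> (e k) ` X)" for k n
  define G where "G = (\<Inter>k m. \<Union>n\<in>{m..}. H k n)"
  have G_sets: "G \<in> sets borel"
  proof -
    have "H k n \<in> sets borel" for n k
    proof -
      have "compact (\<phi> (e k) ` X)"
        using continuous_letter[OF eE] X_compact by (rule compact_continuous_image)
      then have "word_map \<phi> \<omega> n ` \<phi> (e k) ` X \<in> sets borel" if "\<omega> \<in> words E" for \<omega>
        using that compact_word_map_image by (intro borel_compact)
      \<comment> \<open>The union is indexed by the countably many maps of level \<open>n\<close>,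
        since the words themselves are uncountable.\<close>
      then have "\<Union>((\<lambda>f. f ` \<phi> (e k) ` X) ` (\<lambda>\<omega>. word_map \<phi> \<omega> n) ` words E) \<in> sets borel"
        using countable_word_maps[OF countable_alphabet] by (intro sets.countable_UN'') auto
      then show ?thesis by (simp add: H_def image_image)
    qed
    then show ?thesis unfolding G_def
      by (intro sets.countable_INT'' sets.countable_UN'') auto
  qed
  have "AE \<omega> in bernoulli_measure. \<forall>k m. \<exists>n\<ge>m. \<omega> n = e k"
    by (simp add: AE_all_countable AE_letter_occurs eE)
  then have "AE \<omega> in bernoulli_measure. coding_map \<phi> X \<omega> \<in> G"
  proof (rule AE_mp, intro AE_I2 impI)
    fix \<omega> assume \<omega>: "\<omega> \<in> space bernoulli_measure" "\<forall>k m. \<exists>n\<ge>m. \<omega> n = e k"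
    have "coding_map \<phi> X \<omega> \<in> (\<Union>n\<in>{m..}. H k n)" for k m
    proof -
      obtain n where n: "n \<ge> m" "\<omega> n = e k" using \<omega>(2) by blast
      have \<omega>w: "\<omega> \<in> words E" using \<omega>(1) by (simp add: space_bernoulli)
      have "coding_map \<phi> X \<omega> \<in> word_map \<phi> \<omega> n ` \<phi> (e k) ` X"
        using coding_map_in[OF \<omega>w, of "Suc n"] n(2) by (simp add: image_comp)
      with n \<omega>w show ?thesis unfolding H_def by blast
    qed
    then show "coding_map \<phi> X \<omega> \<in> G" by (simp add: G_def)
  qed
  then have "AE x in conformal_measure E \<phi> X h. x \<in> G"
    unfolding conformal_measure_def symbolic_conformal_measure_eq
    by (subst AE_distr_iff[OF measurable_coding_map]) (use G_sets in auto)
  then show ?thesis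
  proof (rule AE_mp, intro AE_I2 impI)
    fix x assume x: "x \<in> G"
    \<comment> \<open>Choosing \<open>k\<close> as a function of \<open>c\<close> alone yields the
      scale bound \<open>R (k c)\<close>, independent of \<open>m\<close>.\<close>
    have "\<exists>k::nat. 0 < c \<longrightarrow> 1 / real (Suc k) < c" for c :: real
      using nat_approx_posE[of c] by blast
    then obtain k where k: "\<And>c. 0 < c \<Longrightarrow> 1 / real (Suc (k c)) < c" by metis
    show "\<not> porous_at (limit_set E \<phi> X) x"
    proof (rule not_porous_atI[where B = "\<lambda>c. R (k c)"])
      fix c :: real and m :: nat assume c: "0 < c"
      obtain n \<omega> where "n \<ge> m" "\<omega> \<in> words E" "x \<in> word_map \<phi> \<omega> n ` \<phi> (e (k c)) ` X"
      proof -
        have "x \<in> (\<Union>n\<in>{m..}. H (k c) n)" using x by (simp only: G_def INT_iff UNIV_I)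
        then obtain n where "n \<ge> m" "x \<in> H (k c) n" by auto
        then show ?thesis using that unfolding H_def by blast
      qed
      then show "\<exists>c' e' R'. \<exists>n\<ge>m. \<exists>\<omega>\<in>words E. 0 < c' \<and> c' < c \<and> R' \<le> R (k c) \<and>
          dense_letter c' e' R' \<and> x \<in> word_map \<phi> \<omega> n ` \<phi> e' ` X"
        using eR[of "k c"] k[OF c] by (intro exI[of _ "1 / Suc (k c)"] exI[of _ "e (k c)"] exI[of _ "R (k c)"]) auto
    qed
  qed
qed

end

section \<open>An inverted lattice of balls\<close>

text \<open>Division by zero gives the value 0 at the origin, so the map is an involution of the
  whole space.\<close>

definition inversion :: "'a::real_inner \<Rightarrow> 'a" where
  "inversion x = x /\<^sub>R (norm x)\<^sup>2"

lemma norm_inversion: "norm (inversion x) = 1 / norm x"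
  by (cases "x = 0") (simp_all add: inversion_def power2_eq_square field_simps)

lemma inversion_inversion: "inversion (inversion x) = x"
  by (cases "x = 0") (simp_all add: inversion_def norm_inversion[unfolded inversion_def] power2_eq_square field_simps)

lemma dist_inversion:
  fixes x y :: "'a::real_inner"
  assumes "x \<noteq> 0" "y \<noteq> 0"
  shows "dist (inversion x) (inversion y) = dist x y / (norm x * norm y)"
proof -
  have xy: "norm x > 0" "norm y > 0" using assms by auto
  have "(dist (inversion x) (inversion y))\<^sup>2 = (norm x)\<^sup>2 / ((norm x)\<^sup>2)\<^sup>2 + (norm y)\<^sup>2 / ((norm y)\<^sup>2)\<^sup>2
      - 2 * (x \<bullet> y) / ((norm x)\<^sup>2 * (norm y)\<^sup>2)"
    unfolding dist_norm power2_norm_eq_inner inversion_def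
    by (simp add: inner_diff_left inner_diff_right inner_commute field_simps power2_eq_square)
  also have "\<dots> = ((norm x)\<^sup>2 + (norm y)\<^sup>2 - 2 * (x \<bullet> y)) / (norm x * norm y)\<^sup>2"
    using xy by (simp add: field_simps power2_eq_square)
  also have "(norm x)\<^sup>2 + (norm y)\<^sup>2 - 2 * (x \<bullet> y) = (dist x y)\<^sup>2"
    unfolding dist_norm power2_norm_eq_inner by (simp add: inner_diff_left inner_diff_right inner_commute)
  finally have "(dist (inversion x) (inversion y))\<^sup>2 = (dist x y / (norm x * norm y))\<^sup>2"
    by (simp add: power_divide)
  then show ?thesis by (rule power2_eq_imp_eq) auto
qed

text \<open>With \<open>d = dist x y\<close>, the norm of \<open>y\<close> is at most
  \<open>norm x + d\<close>, and \<open>d / (norm x + d)\<close> increases with \<open>d\<close>.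
  The resulting bound depends on \<open>x\<close> alone and serves as the gap around
  \<open>inversion x\<close>.\<close>

lemma dist_inversion_ge:
  fixes x y :: "'a::real_inner"
  assumes "x \<noteq> 0" "y \<noteq> 0" "0 < \<eta>" "\<eta> \<le> dist x y"
  shows "\<eta> / (norm x * (norm x + \<eta>)) \<le> dist (inversion x) (inversion y)"
proof -
  have xy: "norm x > 0" "norm y > 0" using assms by auto
  have "norm y \<le> norm x + dist x y" unfolding dist_norm by norm
  then have "\<eta> * norm y \<le> \<eta> * (norm x + dist x y)" using assms(3) by simp
  also have "\<dots> \<le> dist x y * (norm x + \<eta>)"
    using mult_right_mono[OF assms(4), of "norm x"] by (simp add: algebra_simps)
  finally have "\<eta> / (norm x + \<eta>) \<le> dist x y / norm y"
    using xy assms(3) add_pos_pos[OF xy(1) assms(3)] by (simp add: pos_divide_le_eq pos_le_divide_eq)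
  then have "\<eta> / (norm x + \<eta>) / norm x \<le> dist x y / norm y / norm x"
    using xy by (intro divide_right_mono) auto
  then show ?thesis using dist_inversion[OF assms(1,2)] by (simp add: mult.commute)
qed

text \<open>Centres in the unit ball and images of radius \<open>2 * r e \<le> 1 / 2\<close> keep
  every image inside the ball of radius 2. The factors 2 in \<open>sep\<close> are the radius of
  \<open>X\<close>, so the hypothesis separates even the closed images.\<close>

lemma unity_cifs_balls:
  fixes a :: "'e \<Rightarrow> 'a::euclidean_space" and r :: "'e \<Rightarrow> real"
  assumes E: "countable E" "\<exists>a\<in>E. \<exists>b\<in>E. a \<noteq> b"
    and a: "\<And>e. e \<in> E \<Longrightarrow> norm (a e) \<le> 1"
    and r: "\<And>e. e \<in> E \<Longrightarrow> 0 < r e \<and> r e \<le> 1 / 4"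
    and sep: "\<And>e f. e \<in> E \<Longrightarrow> f \<in> E \<Longrightarrow> e \<noteq> f \<Longrightarrow> 2 * r e + 2 * r f < dist (a e) (a f)"
    and h: "0 < h" "((\<lambda>e. r e powr h) has_sum 1) E"
  defines "\<phi> \<equiv> \<lambda>e x. a e + r e *\<^sub>R x"
  shows "unity_cifs E \<phi> (cball 0 2) UNIV h"
    and "\<And>e. e \<in> E \<Longrightarrow> \<phi> e ` cball 0 2 \<subseteq> cball (a e) (2 * r e)"
    and "\<And>e f. e \<in> E \<Longrightarrow> f \<in> E \<Longrightarrow> e \<noteq> f \<Longrightarrow> \<phi> e ` cball 0 2 \<inter> \<phi> f ` cball 0 2 = {}"
proof -
  have dist: "dist (\<phi> e x) (\<phi> e y) = r e * dist x y" if "e \<in> E" for e x y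
    using r[OF that] by (simp add: \<phi>_def dist_norm flip: scaleR_diff_right)
  have ratio: "similarity_ratio (\<phi> e) = r e" if "e \<in> E" for e
    using dist[OF that] by (rule similarity_ratio_eqI)
  show img: "\<phi> e ` cball 0 2 \<subseteq> cball (a e) (2 * r e)" if "e \<in> E" for e
    using r[OF that] by (auto simp: \<phi>_def dist_norm mult.commute)
  show disj: "\<phi> e ` cball 0 2 \<inter> \<phi> f ` cball 0 2 = {}" if ef: "e \<in> E" "f \<in> E" "e \<noteq> f" for e f
  proof (rule ccontr)
    assume "\<not> ?thesis"
    then obtain x where "x \<in> cball (a e) (2 * r e)" "x \<in> cball (a f) (2 * r f)"
      using img[OF ef(1)] img[OF ef(2)] by blast
    then have "dist (a e) (a f) \<le> 2 * r e + 2 * r f"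
      using dist_triangle2[of "a e" "a f" x] by simp
    with sep[OF ef] show False by simp
  qed
  show "unity_cifs E \<phi> (cball 0 2) UNIV h"
  proof
    show "\<exists>s. 0 < s \<and> s < 1 \<and> (\<forall>e\<in>E. similarity_ratio (\<phi> e) \<le> s)"
      using r ratio by (intro exI[of _ "1/4"]) auto
    show "similarity (\<phi> e)" if "e \<in> E" for e
      unfolding similarity_def using dist[OF that] r[OF that] by blast
    show "\<phi> e ` cball 0 2 \<subseteq> cball 0 2" if "e \<in> E" for e
    proof
      fix x assume "x \<in> \<phi> e ` cball 0 2"
      then have "dist (a e) x \<le> 2 * r e" using img[OF that] by auto
      then have "norm x \<le> norm (a e) + 2 * r e" unfolding dist_norm by norm
      then show "x \<in> cball 0 2" using a[OF that] r[OF that] by simp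
    qed
    show "\<phi> e ` interior (cball 0 2) \<inter> \<phi> f ` interior (cball 0 2) = {}"
      if "e \<in> E" "f \<in> E" "e \<noteq> f" for e f
      using disj[OF that] interior_subset by blast
    show "((\<lambda>e. similarity_ratio (\<phi> e) powr h) has_sum 1) E"
      using h(2) ratio by (subst has_sum_cong[where g = "\<lambda>e. r e powr h"]) auto
  qed (use E h(1) in auto)
qed

text \<open>Letters outside \<open>B\<close> get tiny ratios; the remaining mass is shared equally by \<open>B\<close>.\<close>

lemma ratios_with_bounds:
  fixes D B :: "'k::countable set" and g :: "'k \<Rightarrow> real"
  assumes B: "finite B" "B \<noteq> {}" "B \<subseteq> D" and h: "0 < h"
    and g: "\<And>k. k \<in> D \<Longrightarrow> 0 < g k" "\<And>k. k \<in> B \<Longrightarrow> (1 / card B) powr (1 / h) < g k"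
  shows "\<exists>r. (\<forall>k\<in>D. 0 < r k \<and> r k < g k) \<and> ((\<lambda>k. r k powr h) has_sum 1) D"
proof -
  have N: "card B > 0" using B by (simp add: card_gt_0_iff)
  \<comment> \<open>The values stand for ratios to the power \<open>h\<close>. The first term keeps
    the ratio at most \<open>g k / 2\<close>, the second keeps the total at most
    \<open>1 / 2\<close>.\<close>
  define v where "v k = min ((g k / 2) powr h) ((1 / 2) ^ Suc (to_nat k) / 2)" for k
  have v_pos: "0 < v k" if "k \<in> D" for k using g(1)[OF that] by (simp add: v_def)
  have "((\<lambda>i. (1 / 2 :: real) ^ Suc i) has_sum 1) UNIV"
    using power_half_series by (intro sums_nonneg_imp_has_sum) auto
  then have geo: "((\<lambda>i. (1 / 2 :: real) ^ Suc i / 2) has_sum (1 / 2)) UNIV"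
    by (rule has_sum_divide_const)
  have geo': "(\<lambda>k :: 'k. (1 / 2 :: real) ^ Suc (to_nat k) / 2) summable_on (D - B)"
    "infsum (\<lambda>k :: 'k. (1 / 2 :: real) ^ Suc (to_nat k) / 2) (D - B) \<le> 1 / 2"
  proof -
    have s: "(\<lambda>i. (1 / 2 :: real) ^ Suc i / 2) summable_on to_nat ` (D - B)"
      using geo by (rule summable_on_subset[OF has_sum_imp_summable]) auto
    have inj: "inj_on to_nat (D - B)" by (simp add: inj_on_def)
    show "(\<lambda>k :: 'k. (1 / 2 :: real) ^ Suc (to_nat k) / 2) summable_on (D - B)"
      using s summable_on_reindex[OF inj, of "\<lambda>i. (1 / 2 :: real) ^ Suc i / 2"] by (simp add: o_def)
    have "infsum (\<lambda>k :: 'k. (1 / 2 :: real) ^ Suc (to_nat k) / 2) (D - B)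
        = infsum (\<lambda>i. (1 / 2 :: real) ^ Suc i / 2) (to_nat ` (D - B))"
      using infsum_reindex[OF inj, of "\<lambda>i. (1 / 2 :: real) ^ Suc i / 2"] by (simp add: o_def)
    also have "\<dots> \<le> infsum (\<lambda>i. (1 / 2 :: real) ^ Suc i / 2) UNIV"
      using geo s by (intro infsum_mono2) (auto simp: has_sum_iff)
    also have "\<dots> = 1 / 2" using geo by (simp add: has_sum_iff)
    finally show "infsum (\<lambda>k :: 'k. (1 / 2 :: real) ^ Suc (to_nat k) / 2) (D - B) \<le> 1 / 2" .
  qed
  have v_sum: "v summable_on (D - B)"
    using geo'(1) by (rule summable_on_comparison_test) (use v_pos in \<open>auto simp: v_def intro: less_imp_le\<close>)
  define \<sigma> where "\<sigma> = infsum v (D - B)"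
  have \<sigma>: "0 \<le> \<sigma>" "\<sigma> \<le> 1 / 2"
  proof -
    show "0 \<le> \<sigma>" unfolding \<sigma>_def using v_pos by (intro infsum_nonneg) (auto intro: less_imp_le)
    have "\<sigma> \<le> infsum (\<lambda>k. (1 / 2) ^ Suc (to_nat k) / 2) (D - B)"
      unfolding \<sigma>_def using v_sum geo'(1) by (rule infsum_mono) (simp add: v_def)
    with geo'(2) show "\<sigma> \<le> 1 / 2" by linarith
  qed
  \<comment> \<open>The mass left to \<open>B\<close> is at most 1, so each share is at most
    \<open>1 / card B\<close>, the value for which \<open>g\<close> was required to leave
    room.\<close>
  define w where "w k = (if k \<in> B then (1 - \<sigma>) / card B else v k)" for k
  have w_pos: "0 < w k" if "k \<in> D" for k
    using that v_pos \<sigma> N by (simp add: w_def)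
  have "(w has_sum (\<Sum>k\<in>B. w k)) B" using B by (intro has_sum_finite)
  moreover have "(\<Sum>k\<in>B. w k) = 1 - \<sigma>" using N by (simp add: w_def)
  moreover have "(w has_sum \<sigma>) (D - B)"
    using has_sum_infsum[OF v_sum] by (subst has_sum_cong[where g = v]) (auto simp: w_def \<sigma>_def)
  ultimately have "(w has_sum (1 - \<sigma> + \<sigma>)) (B \<union> (D - B))"
    by (intro has_sum_Un_disjoint) auto
  moreover have "B \<union> (D - B) = D" using B by blast
  ultimately have w_sum: "(w has_sum 1) D" by simp
  show ?thesis
  proof (intro exI[of _ "\<lambda>k. w k powr (1 / h)"] conjI ballI)
    fix k assume k: "k \<in> D"
    have "w k powr (1 / h) < g k"
    proof (cases "k \<in> B")
      case True
      have "w k \<le> 1 / card B" using True \<sigma> N by (simp add: w_def divide_right_mono)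
      then have "w k powr (1 / h) \<le> (1 / card B) powr (1 / h)"
        using w_pos[OF k] h by (intro powr_mono2) auto
      with g(2)[OF True] show ?thesis by simp
    next
      case False
      have "w k powr (1 / h) \<le> ((g k / 2) powr h) powr (1 / h)"
        using w_pos[OF k] h False by (intro powr_mono2) (auto simp: w_def v_def)
      also have "\<dots> = g k / 2" using h g(1)[OF k] by (simp add: powr_powr)
      finally show ?thesis using g(1)[OF k] by simp
    qed
    then show "w k powr (1 / h) < g k" .
    show "0 < w k powr (1 / h)" using w_pos[OF k] by simp
  next
    show "((\<lambda>k. (w k powr (1 / h)) powr h) has_sum 1) D"
      using w_sum h w_pos by (subst has_sum_cong[where g = w]) (auto simp: powr_powr less_imp_le)
  qed
qed

section \<open>The lattice, its inverted gaps and its density\<close>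

definition lattice_point :: "nat \<Rightarrow> ('n::finite \<Rightarrow> int) \<Rightarrow> real ^ 'n" where
  "lattice_point m k = (\<chi> i. of_int (k i) / real m)"

text \<open>Norm at least 1 places the inverted points in the closed unit ball.\<close>

definition outer_lattice :: "nat \<Rightarrow> ('n::finite \<Rightarrow> int) set" where
  "outer_lattice m = {k. 1 \<le> norm (lattice_point m k)}"

text \<open>The bound of \<open>dist_inversion_ge\<close> for lattice spacing \<open>1 / m\<close>:
  a lower bound for the distance from the inverted point to all other centres.\<close>

definition lattice_gap :: "nat \<Rightarrow> ('n::finite \<Rightarrow> int) \<Rightarrow> real" where
  "lattice_gap m k = (1 / m) / (norm (lattice_point m k) * (norm (lattice_point m k) + 1 / m))"

lemma dist_lattice_point_ge:
  assumes "k \<noteq> l"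
  shows "1 / m \<le> dist (lattice_point m k) (lattice_point m l)"
proof -
  obtain i where "k i \<noteq> l i" using assms by blast
  then have "1 \<le> \<bar>real_of_int (k i) - real_of_int (l i)\<bar>" by linarith
  then have "1 / m \<le> \<bar>real_of_int (k i) - real_of_int (l i)\<bar> / m" by (simp add: divide_right_mono)
  also have "\<dots> = \<bar>(lattice_point m k - lattice_point m l) $ i\<bar>"
    by (simp add: lattice_point_def flip: diff_divide_distrib)
  also have "\<dots> \<le> dist (lattice_point m k) (lattice_point m l)"
    unfolding dist_norm by (rule component_le_norm_cart)
  finally show ?thesis .
qed

lemma lattice_gap_le_dist:
  assumes "0 < m" "k \<in> outer_lattice m" "l \<in> outer_lattice m" "k \<noteq> l"
  shows "lattice_gap m k \<le> dist (inversion (lattice_point m k)) (inversion (lattice_point m l))"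
  unfolding lattice_gap_def
  using assms dist_lattice_point_ge[OF assms(4), of m]
  by (intro dist_inversion_ge) (auto simp: outer_lattice_def)

lemma lattice_gap_pos: "0 < m \<Longrightarrow> k \<in> outer_lattice m \<Longrightarrow> 0 < lattice_gap m k"
  by (auto simp: lattice_gap_def outer_lattice_def intro!: divide_pos_pos mult_pos_pos add_pos_pos)

lemma lattice_gap_le:
  assumes "0 < m" "k \<in> outer_lattice m"
  shows "lattice_gap m k \<le> 1 / (norm (lattice_point m k))\<^sup>2"
proof -
  have z: "1 \<le> norm (lattice_point m k)" using assms(2) by (simp add: outer_lattice_def)
  have "1 / real m \<le> 1" using assms(1) by simp
  then show ?thesis unfolding lattice_gap_def power2_eq_square
    using z assms(1) by (intro frac_le mult_left_mono mult_pos_pos) auto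
qed

text \<open>Coordinates are rounded down. The bound is crude, but what matters later is only that it
  does not depend on \<open>v\<close>.\<close>

lemma lattice_approximation:
  fixes v :: "real ^ 'n"
  assumes "0 < m"
  shows "\<exists>k. dist (lattice_point m k) v \<le> CARD('n)"
proof -
  define k where "k i = \<lfloor>real m * v $ i\<rfloor>" for i
  have "\<bar>(lattice_point m k - v) $ i\<bar> \<le> 1" for i
  proof -
    have "\<bar>real_of_int (k i) - m * v $ i\<bar> \<le> 1" unfolding k_def by linarith
    then have "\<bar>real_of_int (k i) - m * v $ i\<bar> / m \<le> 1 / m" using assms by (simp add: divide_right_mono)
    also have "1 / real m \<le> 1" using assms by simp
    also have "\<bar>real_of_int (k i) - m * v $ i\<bar> / m = \<bar>(lattice_point m k - v) $ i\<bar>"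
    proof -
      have "(lattice_point m k - v) $ i = (real_of_int (k i) - m * v $ i) / m"
        using assms by (simp add: lattice_point_def field_simps)
      then show ?thesis by (simp add: abs_divide)
    qed
    finally show ?thesis .
  qed
  then have "(\<Sum>i\<in>UNIV. \<bar>(lattice_point m k - v) $ i\<bar>) \<le> CARD('n)"
    using sum_mono[of UNIV "\<lambda>i. \<bar>(lattice_point m k - v) $ i\<bar>" "\<lambda>_. 1"] by simp
  then show ?thesis
    unfolding dist_norm using norm_le_l1_cart order_trans by blast
qed

text \<open>Near \<open>inversion z\<close> with \<open>norm z = K\<close> large, the inverted lattice has mesh of order \<open>K\<^sup>-\<^sup>2\<close>, while
  the ball under consideration has radius \<open>1 / (4 * K)\<close>.\<close>

lemma inverted_lattice_dense:
  fixes r :: "('n::finite \<Rightarrow> int) \<Rightarrow> real"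
  assumes m: "0 < m" and c: "0 < c"
    and r: "\<And>k. k \<in> outer_lattice m \<Longrightarrow> 0 < r k \<and> r k < lattice_gap m k / 4"
  shows "\<exists>k\<in>outer_lattice m. \<exists>R>0. \<forall>x\<in>cball (inversion (lattice_point m k)) (2 * r k). \<forall>y.
    ball y (c * R) \<subseteq> ball x R \<longrightarrow>
    (\<exists>l\<in>outer_lattice m. cball (inversion (lattice_point m l)) (2 * r l) \<subseteq> ball y (c * R))"
proof -
  define n where "n = real CARD('n)"
  have n: "1 \<le> n" unfolding n_def by (simp add: Suc_leI)
  \<comment> \<open>Two demands on the norm \<open>K\<close> are combined: \<open>3 * n < K\<close>
    keeps the lattice point found below at norm above \<open>K / 3\<close>, and
    \<open>36 * n / c < K\<close> is the final inequality
    \<open>9 * n / K^2 < c * R\<close>.\<close>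
  obtain N :: nat where N: "3 * n + 36 * n / c < N" using reals_Archimedean2 by blast
  define k :: "'n \<Rightarrow> int" where "k = (\<lambda>_. int (m * N))"
  define K where "K = norm (lattice_point m k)"
  obtain i :: 'n where True by blast
  have "real N = \<bar>lattice_point m k $ i\<bar>" using m by (simp add: lattice_point_def k_def)
  also have "\<dots> \<le> K" unfolding K_def by (rule component_le_norm_cart)
  finally have "3 * n + 36 * n / c < K" using N by simp
  moreover have "0 < 36 * n / c" using n c by simp
  ultimately have K: "3 * n < K" "36 * n / c < K" "3 < K" using n by auto
  have k: "k \<in> outer_lattice m" using K by (simp add: outer_lattice_def K_def)
  \<comment> \<open>A quarter of the distance \<open>1 / K\<close> from the centre to the origin.
    The piece has radius at most \<open>1 / (4 * K)\<close> too, so \<open>y\<close> stays within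
    \<open>1 / (2 * K)\<close> of the centre and away from the origin.\<close>
  define R where "R = 1 / (4 * K)"
  have R: "0 < R" using K by (simp add: R_def)
  have r_le: "2 * r l \<le> 1 / (2 * (norm (lattice_point m l))\<^sup>2)" if "l \<in> outer_lattice m" for l
    using r[OF that] lattice_gap_le[OF m that] by simp
  have "\<exists>l\<in>outer_lattice m. cball (inversion (lattice_point m l)) (2 * r l) \<subseteq> ball y (c * R)"
    if x: "x \<in> cball (inversion (lattice_point m k)) (2 * r k)" and y: "ball y (c * R) \<subseteq> ball x R" for x y
  proof -
    have "y \<in> ball x R" using y c R by (meson centre_in_ball mult_pos_pos subsetD)
    have "1 / (2 * K\<^sup>2) \<le> 1 / (4 * K)"
      using K by (simp add: power2_eq_square field_simps)
    then have "2 * r k \<le> 1 / (4 * K)" using r_le[OF k] by (simp add: K_def)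
    then have "dist (inversion (lattice_point m k)) y < 1 / (4 * K) + 1 / (4 * K)"
      using x \<open>y \<in> ball x R\<close> dist_triangle[of "inversion (lattice_point m k)" y x] by (simp add: R_def)
    then have "dist (inversion (lattice_point m k)) y < 1 / (2 * K)" by simp
    moreover have "norm (inversion (lattice_point m k)) = 1 / K" by (simp add: norm_inversion K_def)
    moreover have "norm y \<le> norm (inversion (lattice_point m k)) + dist (inversion (lattice_point m k)) y"
      "norm (inversion (lattice_point m k)) \<le> norm y + dist (inversion (lattice_point m k)) y"
      unfolding dist_norm by norm+
    ultimately have "1 / K - 1 / (2 * K) < norm y" "norm y < 1 / K + 1 / (2 * K)" by linarith+
    then have ny: "1 / (2 * K) < norm y" "norm y < 3 / (2 * K)" using K by (simp_all add: field_simps)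
    have y0: "0 < norm y" using ny(1) K by (smt (verit) divide_pos_pos)
    \<comment> \<open>The approximation takes place before inversion: a lattice point within
      \<open>n\<close> of \<open>v\<close> is inverted to a centre within order
      \<open>n / K^2\<close> of \<open>y\<close>.\<close>
    define v where "v = inversion y"
    have nv: "2 * K / 3 < norm v"
      using ny(2) y0 K by (simp add: v_def norm_inversion field_simps)
    obtain l where l: "dist (lattice_point m l) v \<le> n"
      using lattice_approximation[OF m] unfolding n_def by blast
    define z where "z = lattice_point m l"
    have "norm v \<le> norm z + dist z v" unfolding dist_norm by norm
    then have nz: "K / 3 < norm z" using l nv K by (simp add: z_def)
    then have lD: "l \<in> outer_lattice m" using K by (simp add: outer_lattice_def z_def)
    have "dist (inversion z) y = dist (inversion z) (inversion v)" by (simp add: v_def inversion_inversion)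
    also have "\<dots> = dist z v / (norm z * norm v)"
      using nz nv K by (intro dist_inversion) auto
    also have "\<dots> \<le> n / ((K / 3) * (2 * K / 3))"
      using l nz nv K n by (intro frac_le mult_mono mult_pos_pos) (auto simp: z_def)
    also have "\<dots> = 9 * n / (2 * K\<^sup>2)" using K by (simp add: power2_eq_square field_simps)
    finally have d: "dist (inversion z) y \<le> 9 * n / (2 * K\<^sup>2)" .
    have "2 * r l \<le> 1 / (2 * (norm z)\<^sup>2)" using r_le[OF lD] by (simp add: z_def)
    also have "\<dots> \<le> 1 / (2 * (K / 3)\<^sup>2)"
      using nz K by (intro frac_le mult_left_mono power_mono) auto
    also have "\<dots> = 9 / (2 * K\<^sup>2)" using K by (simp add: power2_eq_square field_simps)
    also have "\<dots> \<le> 9 * n / (2 * K\<^sup>2)" using n K by (intro divide_right_mono) auto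
    finally have "dist (inversion z) y + 2 * r l \<le> 9 * n / (2 * K\<^sup>2) + 9 * n / (2 * K\<^sup>2)" using d by simp
    also have "\<dots> = 9 * n / K\<^sup>2" by simp
    also have "\<dots> < c * R"
      using K c by (simp add: R_def power2_eq_square field_simps)
    finally have "cball (inversion z) (2 * r l) \<subseteq> ball y (c * R)"
    proof (intro subsetI)
      fix u assume *: "dist (inversion z) y + 2 * r l < c * R" "u \<in> cball (inversion z) (2 * r l)"
      then show "u \<in> ball y (c * R)"
        using dist_triangle[of y u "inversion z"] by (simp add: dist_commute)
    qed
    then show ?thesis using lD by (auto simp: z_def)
  qed
  then show ?thesis using k R by blast
qed

text \<open>The points have all coordinates in the interval from 1 to 2, so their norms are bounded
  independently of \<open>m\<close> while their number grows like the power \<open>CARD('n)\<close>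
  of \<open>m\<close>.\<close>

definition lattice_block :: "nat \<Rightarrow> ('n::finite \<Rightarrow> int) set" where
  "lattice_block m = PiE UNIV (\<lambda>_. {int m..<2 * int m})"

lemma finite_lattice_block: "finite (lattice_block m :: ('n::finite \<Rightarrow> int) set)"
  unfolding lattice_block_def by (intro finite_PiE) auto

lemma card_lattice_block: "card (lattice_block m :: ('n::finite \<Rightarrow> int) set) = m ^ CARD('n)"
  unfolding lattice_block_def by (simp add: card_PiE)

lemma lattice_block_norm:
  fixes k :: "'n::finite \<Rightarrow> int"
  assumes m: "0 < m" and k: "k \<in> lattice_block m"
  shows "1 \<le> norm (lattice_point m k)" "norm (lattice_point m k) \<le> 2 * CARD('n)"
proof -
  have b: "1 \<le> lattice_point m k $ i \<and> lattice_point m k $ i \<le> 2" for i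
  proof -
    have "int m \<le> k i" "k i \<le> 2 * int m" using k by (auto simp: lattice_block_def PiE_iff less_imp_le)
    then have "real m \<le> of_int (k i)" "of_int (k i) \<le> 2 * real m" by linarith+
    then show ?thesis using m by (simp add: lattice_point_def field_simps)
  qed
  obtain i :: 'n where True by blast
  have "1 \<le> \<bar>lattice_point m k $ i\<bar>" using b[of i] by simp
  also have "\<dots> \<le> norm (lattice_point m k)" by (rule component_le_norm_cart)
  finally show "1 \<le> norm (lattice_point m k)" .
  have "norm (lattice_point m k) \<le> (\<Sum>i\<in>UNIV. \<bar>lattice_point m k $ i\<bar>)" by (rule norm_le_l1_cart)
  also have "\<dots> \<le> (\<Sum>i\<in>(UNIV :: 'n set). 2)" using b by (intro sum_mono) (smt (verit))
  finally show "norm (lattice_point m k) \<le> 2 * CARD('n)" by simp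
qed

text \<open>The block has \<open>m ^ n\<close> points at mutual distance of order \<open>1 / m\<close>, so there is room for \<open>m ^ n\<close> balls
  with radius \<open>m powr (- n / h)\<close> exactly because \<open>h < n\<close>.\<close>

lemma fine_lattice_exists:
  assumes h: "0 < h" "h < real CARD('n::finite)"
  obtains m where "2 \<le> m" "\<And>k :: 'n \<Rightarrow> int. k \<in> lattice_block m \<Longrightarrow>
    (1 / card (lattice_block m :: ('n \<Rightarrow> int) set)) powr (1 / h) < lattice_gap m k / 4"
proof -
  define n where "n = real CARD('n)"
  have n: "1 \<le> n" unfolding n_def by (simp add: Suc_leI)
  \<comment> \<open>The balls have radius \<open>m powr (- n / h)\<close>. By
    \<open>K \<le> 2 * n\<close> and \<open>1 / m \<le> 1\<close>, a quarter of the gap is at least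
    \<open>1 / m\<close> times \<open>1 / (8 * n * (2 * n + 1))\<close>; the quotient of radius and
    \<open>1 / m\<close> has this negative exponent and tends to 0.\<close>
  have neg: "1 - n / h < 0" using h by (simp add: n_def field_simps)
  have "(\<lambda>m. real m powr (1 - n / h)) \<longlonglongrightarrow> 0"
    using neg by (intro tendsto_neg_powr filterlim_real_sequentially)
  then have "eventually (\<lambda>m. real m powr (1 - n / h) < 1 / (8 * n * (2 * n + 1))) sequentially"
    using n by (intro order_tendstoD) auto
  then have "eventually (\<lambda>m. 2 \<le> m \<and> real m powr (1 - n / h) < 1 / (8 * n * (2 * n + 1))) sequentially"
    using eventually_ge_at_top[of 2] by eventually_elim simp
  then obtain m :: nat where m: "2 \<le> m" "real m powr (1 - n / h) < 1 / (8 * n * (2 * n + 1))"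
    using eventually_happens by fastforce
  show ?thesis
  proof (rule that[OF m(1)])
    fix k :: "'n \<Rightarrow> int" assume k: "k \<in> lattice_block m"
    have m0: "0 < m" using m(1) by simp
    define K where "K = norm (lattice_point m k)"
    have K: "1 \<le> K" "K \<le> 2 * n" using lattice_block_norm[OF m0 k] by (auto simp: K_def n_def)
    have "(1 / card (lattice_block m :: ('n \<Rightarrow> int) set)) powr (1 / h) = (real m powr (- n)) powr (1 / h)"
      using m0 by (simp add: card_lattice_block n_def powr_minus_divide powr_realpow)
    also have "\<dots> = real m powr ((1 - n / h) + (- 1))" by (simp add: powr_powr)
    also have "\<dots> = real m powr (1 - n / h) * (1 / m)"
      using m0 by (subst powr_add) (simp add: powr_minus_divide)
    also have "\<dots> < 1 / (8 * n * (2 * n + 1)) * (1 / m)"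
      using m m0 by (intro mult_strict_right_mono) auto
    also have "\<dots> = (1 / m) / (2 * n * (2 * n + 1)) / 4" by (simp add: field_simps)
    also have "\<dots> \<le> (1 / m) / (K * (K + 1 / m)) / 4"
      using K m0 n by (intro divide_right_mono divide_left_mono mult_mono add_mono mult_pos_pos add_pos_pos) auto
    also have "\<dots> = lattice_gap m k / 4" by (simp add: lattice_gap_def K_def)
    finally show "(1 / card (lattice_block m :: ('n \<Rightarrow> int) set)) powr (1 / h) < lattice_gap m k / 4" .
  qed
qed

section \<open>Choice of mesh and ratios, and assembly of the system\<close>

theorem theorem3p16:
  fixes h :: real
  assumes "0 < h" and "h < real CARD('n::finite)"
  shows "\<exists>(E :: nat set) (\<phi> :: nat \<Rightarrow> real ^ 'n \<Rightarrow> real ^ 'n) X W.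
    similarity_cifs E \<phi> X W \<and>
    hausdorff_dim (limit_set E \<phi> X) = ereal h \<and>
    (\<exists>!M. transfer_eigenmeasure E \<phi> h M) \<and>
    (AE x in conformal_measure E \<phi> X h.
       x \<in> limit_set E \<phi> X \<longrightarrow> \<not> porous_at (limit_set E \<phi> X) x)"
proof -
  obtain m where m: "2 \<le> m" and gap: "\<And>k :: 'n \<Rightarrow> int. k \<in> lattice_block m \<Longrightarrow>
      (1 / card (lattice_block m :: ('n \<Rightarrow> int) set)) powr (1 / h) < lattice_gap m k / 4"
    using fine_lattice_exists[OF assms] by metis
  have m0: "0 < m" using m by simp
  define D :: "('n \<Rightarrow> int) set" where "D = outer_lattice m"
  have block: "lattice_block m \<subseteq> D"
    using lattice_block_norm(1)[OF m0] by (auto simp: D_def outer_lattice_def)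
  \<comment> \<open>The choice \<open>2 \<le> m\<close> provides the two distinct letters that a
    system needs.\<close>
  have "2 \<le> card (lattice_block m :: ('n \<Rightarrow> int) set)"
    unfolding card_lattice_block using m power_increasing[of 1 "CARD('n)" m] by (simp add: Suc_leI)
  then have "\<not> card (lattice_block m :: ('n \<Rightarrow> int) set) \<le> Suc 0" by simp
  then obtain k1 k2 :: "'n \<Rightarrow> int" where "k1 \<in> lattice_block m" "k2 \<in> lattice_block m" "k1 \<noteq> k2"
    unfolding card_le_Suc0_iff_eq[OF finite_lattice_block] by auto
  then have k12: "k1 \<in> D" "k2 \<in> D" "k1 \<noteq> k2" using block by auto
  have ne: "lattice_block m \<noteq> ({} :: ('n \<Rightarrow> int) set)"
    using \<open>2 \<le> card _\<close> by (metis card.empty not_numeral_le_zero)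
  have gap_pos: "0 < lattice_gap m k / 4" if "k \<in> D" for k :: "'n \<Rightarrow> int"
    using lattice_gap_pos[OF m0] that by (simp add: D_def)
  obtain r where r: "\<forall>k\<in>D. 0 < r k \<and> r k < lattice_gap m k / 4" "((\<lambda>k. r k powr h) has_sum 1) D"
    using ratios_with_bounds[OF finite_lattice_block ne block assms(1), of "\<lambda>k. lattice_gap m k / 4", OF gap_pos gap]
    by auto
  define a where "a k = inversion (lattice_point m k)" for k :: "'n \<Rightarrow> int"
  \<comment> \<open>Letters are natural numbers, so the lattice indices are transported along
    \<open>to_nat\<close>, and \<open>from_nat\<close> recovers them.\<close>
  define E :: "nat set" where "E = to_nat ` D"
  define \<phi> :: "nat \<Rightarrow> real ^ 'n \<Rightarrow> real ^ 'n" where "\<phi> = (\<lambda>e x. a (from_nat e) + r (from_nat e) *\<^sub>R x)"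
  have D_E: "from_nat e \<in> D" if "e \<in> E" for e using that by (auto simp: E_def)
  have inj: "inj_on to_nat D" by (simp add: inj_on_def)
  have norm_a: "norm (a (from_nat e)) \<le> 1" if "e \<in> E" for e
    using D_E[OF that] by (simp add: a_def norm_inversion D_def outer_lattice_def divide_le_eq)
  have r_le: "0 < r (from_nat e) \<and> r (from_nat e) \<le> 1 / 4" if "e \<in> E" for e
  proof -
    have k: "(from_nat e :: 'n \<Rightarrow> int) \<in> outer_lattice m" using D_E[OF that] by (simp add: D_def)
    have "1 \<le> norm (lattice_point m (from_nat e :: 'n \<Rightarrow> int))" using k by (simp add: outer_lattice_def)
    then have "1 / (norm (lattice_point m (from_nat e :: 'n \<Rightarrow> int)))\<^sup>2 \<le> 1"
      by (simp add: divide_le_eq one_le_power)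
    then show ?thesis using r(1)[rule_format, OF D_E[OF that]] lattice_gap_le[OF m0 k] by auto
  qed
  have sep: "2 * r (from_nat e) + 2 * r (from_nat f) < dist (a (from_nat e)) (a (from_nat f))"
    if "e \<in> E" "f \<in> E" "e \<noteq> f" for e f
  proof -
    have *: "from_nat e \<in> D" "from_nat f \<in> D" "from_nat e \<noteq> (from_nat f :: 'n \<Rightarrow> int)"
      using that by (auto simp: E_def)
    then have "lattice_gap m (from_nat e :: 'n \<Rightarrow> int) \<le> dist (a (from_nat e)) (a (from_nat f))"
      "lattice_gap m (from_nat f :: 'n \<Rightarrow> int) \<le> dist (a (from_nat e)) (a (from_nat f))"
      using lattice_gap_le_dist[OF m0, of "from_nat e :: 'n \<Rightarrow> int" "from_nat f"]
        lattice_gap_le_dist[OF m0, of "from_nat f :: 'n \<Rightarrow> int" "from_nat e"]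
      by (simp_all add: D_def a_def dist_commute)
    \<comment> \<open>Each ratio is below a quarter of its own gap, so each doubled ratio is below
      half of the distance between the centres.\<close>
    then show ?thesis using r(1)[rule_format, OF *(1)] r(1)[rule_format, OF *(2)] by linarith
  qed
  have sum: "((\<lambda>e. r (from_nat e) powr h) has_sum 1) E"
    unfolding E_def using r(2) by (subst has_sum_reindex[OF inj]) (simp add: o_def)
  have two: "\<exists>a\<in>E. \<exists>b\<in>E. a \<noteq> b" using k12 unfolding E_def by (metis imageI from_nat_to_nat)
  note system = unity_cifs_balls[of E "\<lambda>e. a (from_nat e)" "\<lambda>e. r (from_nat e)" h,
      OF _ two norm_a r_le sep assms(1) sum, folded \<phi>_def, simplified]
  have img: "\<phi> e ` cball 0 2 \<subseteq> cball (a (from_nat e)) (2 * r (from_nat e))" if "e \<in> E" for e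
    using system(2)[OF that] by (simp add: \<phi>_def)
  have disj: "\<phi> e ` cball 0 2 \<inter> \<phi> f ` cball 0 2 = {}" if "e \<in> E" "f \<in> E" "e \<noteq> f" for e f
    using system(3)[OF that] by (simp add: \<phi>_def)
  interpret unity_cifs E \<phi> "cball 0 2" UNIV h by (rule system(1))
  have "\<exists>e R. dense_letter c e R" if c: "0 < c" for c
  proof -
    obtain k R where k: "k \<in> D" "0 < R" and dense: "\<And>x y. x \<in> cball (a k) (2 * r k) \<Longrightarrow>
        ball y (c * R) \<subseteq> ball x R \<Longrightarrow> \<exists>l\<in>D. cball (a l) (2 * r l) \<subseteq> ball y (c * R)"
      using inverted_lattice_dense[OF m0 c, of r] r(1) unfolding D_def a_def by metis
    have "dense_letter c (to_nat k) R"
      unfolding dense_letter_def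
    proof (intro conjI ballI allI impI)
      show kE: "to_nat k \<in> E" using k by (simp add: E_def)
      fix x y assume xy: "x \<in> \<phi> (to_nat k) ` cball 0 2" "ball y (c * R) \<subseteq> ball x R"
      then have "x \<in> cball (a k) (2 * r k)" using img[OF kE] by auto
      from dense[OF this xy(2)] obtain l where l: "l \<in> D" "cball (a l) (2 * r l) \<subseteq> ball y (c * R)" by blast
      have lE: "to_nat l \<in> E" using l by (simp add: E_def)
      then have "\<phi> (to_nat l) ` cball 0 2 \<subseteq> ball y (c * R)" using img[OF lE] l(2) by auto
      with lE show "\<exists>l\<in>E. \<phi> l ` cball 0 2 \<subseteq> ball y (c * R)" by blast
    qed (rule k(2))
    then show ?thesis by blast
  qed
  then have "AE x in conformal_measure E \<phi> (cball 0 2) h. \<not> porous_at (limit_set E \<phi> (cball 0 2)) x"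
    by (rule AE_not_porous)
  then have "AE x in conformal_measure E \<phi> (cball 0 2) h.
      x \<in> limit_set E \<phi> (cball 0 2) \<longrightarrow> \<not> porous_at (limit_set E \<phi> (cball 0 2)) x"
    by eventually_elim simp
  moreover have "hausdorff_dim (limit_set E \<phi> (cball 0 2)) = ereal h"
    by (rule hausdorff_dim_limit_set[OF disj])
  ultimately show ?thesis
    using similarity_cifs_axioms ex1_eigenmeasure by blast
qed

end
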